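(* The First-Come-First-Served algorithm (\textsc{Fcfs}) for Online Slot Allocation satisfies: (i) For general costs, its competitive ratio on the class of instances whose cost vector has at most $K$ non-maximum coefficients (i.e. $|\{i\in[n]: c_i<\max_j c_j\}|\le K$) is at most $1+H_K$, where $H_K=1+\frac12+\cdots+\frac1K$. (ii) For concave cost vectors (i.e. $c_{i+2}-c_{i+1}\le c_{i+1}-c_i$ for all $i\in[n-2]$), its competitive ratio is at most $2$. (iii) For costs with $c_j=\log_2 j+O(\log\log j)$, \textsc{Fcfs} returns an allocation with expected cost at most $\mathcal{H}(f)+O(\log\mathcal{H}(f))$, where $\mathcal{H}(f)$, the entropy of $f/\sum_i f_i$, satisfies $\mathcal{H}(f)\le \mathrm{OPT}+O(\log \mathrm{OPT})$.
   Context: Online Slot Allocation (OSA). An instance is a pair $(f,c)$: $n$ slots with nonnegative costs $c_1\le c_2\le\cdots\le c_n$ and $n$ items with frequency vector $f\in\mathbb{R}_{+}^n$ (positive entries). Requests are drawn i.i.d. from $f/\sum_i f_i$; whenever a request is for an item $i$ not requested before, the algorithm must place $i$ in a vacant slot $j_i$; play stops once all items have been requested; the assignment cost is $\sum_i f_i c_{j_i}$, and the cost of an algorithm is its expected assignment cost. $\mathrm{OPT}=\mathrm{OPT}(f,c)$ is the minimum assignment cost over all bijections of items to slots (put the $j$th most frequent item in slot $j$). The competitive ratio of an algorithm on a class of instances is the supremum over instances of its cost divided by $\mathrm{OPT}$. \textsc{Fcfs} places the $j$th distinct item requested into slot $j$. In (iii), $f$ is normalized so $\sum_i f_i=1$,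 and $\mathcal{H}(f)=\sum_i f_i\log_2(1/f_i)$; the $O(\cdot)$ terms hide constants depending only on the cost function. *)

theory Defs
  imports
    "HOL-Probability.Probability"
    "HOL-Combinatorics.Permutations"
    "HOL-Analysis.Harmonic_Numbers"
    "HOL-Library.Landau_Symbols"
begin

text \<open>Items and slots are both numbered by \<open>{1..n}\<close>; values of \<open>f\<close> and \<open>c\<close> outside
  this range are irrelevant.\<close>

definition osa_instance :: "nat \<Rightarrow> (nat \<Rightarrow> real) \<Rightarrow> (nat \<Rightarrow> real) \<Rightarrow> bool" where
  "osa_instance n f c \<longleftrightarrow>
     1 \<le> n \<and> (\<forall>i\<in>{1..n}. 0 < f i) \<and> (\<forall>j\<in>{1..n}. 0 \<le> c j) \<and> mono_on {1..n} c"

definition request_pmf :: "nat \<Rightarrow> (nat \<Rightarrow> real) \<Rightarrow> nat pmf" where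
  "request_pmf n f = embed_pmf (\<lambda>i. if i \<in> {1..n} then f i / (\<Sum>k=1..n. f k) else 0)"

text \<open>Requests form an infinite i.i.d. stream. Requests after all items have been seen do not
  influence the assignment, so stopping the play there needs no separate treatment.\<close>

definition request_space :: "nat \<Rightarrow> (nat \<Rightarrow> real) \<Rightarrow> nat stream measure" where
  "request_space n f = stream_space (measure_pmf (request_pmf n f))"

text \<open>An online algorithm knows the number of slots and the costs, but not the frequencies. It is
  consulted when an item is requested for the first time; its last argument is the list of all
  requests so far, ending with that item, and its value is the slot the item is placed in.\<close>

type_synonym osa_algorithm = "nat \<Rightarrow> (nat \<Rightarrow> real) \<Rightarrow> nat list \<Rightarrow> nat"

definition fcfs :: osa_algorithm where
  "fcfs n c h = card (set h)"

definition first_request :: "nat stream \<Rightarrow> nat \<Rightarrow> nat" where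
  "first_request \<omega> i = (LEAST t. \<omega> !! t = i)"

definition slot_of ::
    "osa_algorithm \<Rightarrow> nat \<Rightarrow> (nat \<Rightarrow> real) \<Rightarrow> nat stream \<Rightarrow> nat \<Rightarrow> nat" where
  "slot_of alg n c \<omega> i = alg n c (stake (Suc (first_request \<omega> i)) \<omega>)"

definition assignment_cost ::
    "nat \<Rightarrow> (nat \<Rightarrow> real) \<Rightarrow> (nat \<Rightarrow> real) \<Rightarrow> (nat \<Rightarrow> nat) \<Rightarrow> real" where
  "assignment_cost n f c s = (\<Sum>i=1..n. f i * c (s i))"

definition expected_cost ::
    "osa_algorithm \<Rightarrow> nat \<Rightarrow> (nat \<Rightarrow> real) \<Rightarrow> (nat \<Rightarrow> real) \<Rightarrow> real" where
  "expected_cost alg n f c =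
     (\<integral>\<omega>. assignment_cost n f c (slot_of alg n c \<omega>) \<partial>request_space n f)"

definition opt :: "nat \<Rightarrow> (nat \<Rightarrow> real) \<Rightarrow> (nat \<Rightarrow> real) \<Rightarrow> real" where
  "opt n f c = Min (assignment_cost n f c ` {s. s permutes {1..n}})"

text \<open>The quotient is taken in \<^typ>\<open>ereal\<close>, where \<open>0 / 0 = 0\<close> but \<open>x / 0 = \<infinity>\<close> for \<open>x > 0\<close>; an
  instance with \<open>OPT = 0\<close> is therefore harmless only if the algorithm also has cost \<open>0\<close>.\<close>

definition competitive_ratio ::
    "osa_algorithm \<Rightarrow> (nat \<times> (nat \<Rightarrow> real) \<times> (nat \<Rightarrow> real)) set \<Rightarrow> ereal" where
  "competitive_ratio alg I =
     (SUP (n, f, c) \<in> I. ereal (expected_cost alg n f c) / ereal (opt n f c))"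

definition concave_costs :: "nat \<Rightarrow> (nat \<Rightarrow> real) \<Rightarrow> bool" where
  "concave_costs n c \<longleftrightarrow> (\<forall>i\<in>{1..n - 2}. c (i + 2) - c (i + 1) \<le> c (i + 1) - c i)"

definition frequency_entropy :: "nat \<Rightarrow> (nat \<Rightarrow> real) \<Rightarrow> real" where
  "frequency_entropy n f = (\<Sum>i=1..n. f i * log 2 (1 / f i))"

lemma pmf_request_pmf:
  assumes "osa_instance n f c"
  shows "pmf (request_pmf n f) i = (if i \<in> {1..n} then f i / (\<Sum>k=1..n. f k) else 0)"
proof -
  let ?p = "\<lambda>i. if i \<in> {1..n} then f i / (\<Sum>k=1..n. f k) else 0"
  have pos: "0 < (\<Sum>k=1..n. f k)"
    using assms by (intro sum_pos) (auto simp: osa_instance_def)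
  have nonneg: "0 \<le> ?p j" for j
    using assms pos by (auto simp: osa_instance_def intro!: divide_nonneg_pos less_imp_le)
  have "(\<integral>\<^sup>+ j. ennreal (?p j) \<partial>count_space UNIV) = (\<Sum>j=1..n. ennreal (?p j))"
    by (rule nn_integral_count_space'[of "{1..n}"]) auto
  also have "\<dots> = ennreal (\<Sum>j=1..n. ?p j)"
    by (rule sum_ennreal, rule nonneg)
  also have "(\<Sum>j=1..n. ?p j) = 1"
    using pos by (simp flip: sum_divide_distrib)
  finally have total: "(\<integral>\<^sup>+ j. ennreal (?p j) \<partial>count_space UNIV) = 1"
    by simp
  show ?thesis
    unfolding request_pmf_def by (rule pmf_embed_pmf[OF nonneg total])
qed

lemma measurable_assignment_cost:
  "(\<lambda>\<omega>. assignment_cost n f c (slot_of alg n c \<omega>)) \<in> borel_measurable (request_space n f)"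
proof -
  let ?M = "request_space n f"
  have snth [measurable]: "(\<lambda>\<omega>. \<omega> !! t) \<in> measurable ?M (count_space UNIV)" for t
    unfolding request_space_def
    using measurable_snth[of t "measure_pmf (request_pmf n f)"] by simp
  have stake: "stake k \<in> measurable ?M (count_space UNIV)" for k
    unfolding request_space_def
    by (subst measurable_cong_sets[OF sets_stream_space_cong[of _ "count_space UNIV"] refl])
      (simp_all add: measurable_stake)
  have first: "(\<lambda>\<omega>. first_request \<omega> i) \<in> measurable ?M (count_space UNIV)" for i
    unfolding first_request_def by measurable
  have "(\<lambda>\<omega>. c (slot_of alg n c \<omega> i)) \<in> borel_measurable ?M" for i
    unfolding slot_of_def
    by (rule measurable_compose_countable[OF _ first[of i]], rule measurable_compose[OF stake]) simp
  then show ?thesis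
    unfolding assignment_cost_def by (intro borel_measurable_sum borel_measurable_times) auto
qed

lemma integrable_fcfs:
  assumes "osa_instance n f c"
  shows "integrable (request_space n f) (\<lambda>\<omega>. assignment_cost n f c (slot_of fcfs n c \<omega>))"
proof -
  interpret P: prob_space "request_space n f"
    unfolding request_space_def by (intro prob_space.prob_space_stream_space measure_pmf.prob_space_axioms)
  have set: "set_pmf (request_pmf n f) \<subseteq> {1..n}"
    by (auto simp: set_pmf_eq pmf_request_pmf[OF assms])
  have "AE \<omega> in request_space n f. \<forall>t. \<omega> !! t \<in> {1..n}"
  proof -
    have "AE \<omega> in request_space n f. stream_all (\<lambda>x. x \<in> {1..n}) \<omega>"
      unfolding request_space_def
      using set by (intro prob_space.AE_stream_all measure_pmf.prob_space_axioms)
        (auto simp: AE_measure_pmf_iff)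
    then show ?thesis
      by (simp add: stream.pred_set sset_range)
  qed
  then have "AE \<omega> in request_space n f.
      norm (assignment_cost n f c (slot_of fcfs n c \<omega>)) \<le> (\<Sum>i=1..n. f i * c n)"
  proof eventually_elim
    case (elim \<omega>)
    have "0 \<le> f i * c (slot_of fcfs n c \<omega> i) \<and> f i * c (slot_of fcfs n c \<omega> i) \<le> f i * c n"
      if i: "i \<in> {1..n}" for i
    proof -
      let ?h = "stake (Suc (first_request \<omega> i)) \<omega>"
      have "set ?h \<subseteq> {1..n}"
        using elim by (force simp: in_set_conv_nth stake_nth simp del: stake.simps)
      then have "card (set ?h) \<le> n"
        using card_mono[of "{1..n}" "set ?h"] by simp
      moreover have "1 \<le> card (set ?h)"
        by (simp add: Suc_le_eq card_gt_0_iff)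
      ultimately have slot: "slot_of fcfs n c \<omega> i \<in> {1..n}"
        unfolding slot_of_def fcfs_def atLeastAtMost_iff by blast
      have "0 \<le> c (slot_of fcfs n c \<omega> i)"
        using assms slot unfolding osa_instance_def by blast
      moreover have "c (slot_of fcfs n c \<omega> i) \<le> c n"
        using assms slot unfolding osa_instance_def by (auto intro!: mono_onD[of "{1..n}" c])
      moreover have "0 < f i" using assms i unfolding osa_instance_def by blast
      ultimately show ?thesis by (simp add: mult_left_mono)
    qed
    then show ?case
      unfolding assignment_cost_def real_norm_def
      by (subst abs_of_nonneg) (auto intro!: sum_nonneg sum_mono)
  qed
  then show ?thesis
    by (intro P.integrable_const_bound measurable_assignment_cost)
qed

end

theory Submission
  imports Defs "HOL-Real_Asymp.Real_Asymp"
begin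

text \<open>
  Writing a cost vector as \<open>c\<^sub>1\<close> plus a combination of threshold functions \<open>[k < j]\<close> with weights
  \<open>c\<^bsub>k+1\<^esub> - c\<^sub>k\<close>, both the expected cost of FCFS and the cost of a fixed permutation become linear in
  these weights, and everything depends on the expected weight \<open>M(U, k)\<close> of the items that are not
  among the first \<open>k\<close> distinct items requested from \<open>U\<close>. Conditioning on the first request gives
  \<open>M(U, k+1) = (\<Sum>i\<in>U. f\<^sub>i / f(U) * M(U - {i}, k))\<close>.

  For (i), let \<open>A\<close> be the \<open>k\<close> items that the permutation puts into the first \<open>k\<close> slots and \<open>B\<close> the
  others. Induction on \<open>k\<close> gives \<open>M(A \<union> B, k) \<le> M(A, k) + f(B) (1 + H\<^sub>k)\<close>, because the expected weight
  \<open>M(A, k) - M(A, k+1)\<close> of the \<open>(k+1)\<close>-st item of a size-biased ordering decreases with \<open>k\<close> and is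
  therefore at most \<open>f(A) / (k+1)\<close>.

  For (ii), the increments decrease, so by Abel summation it suffices to compare partial sums of
  \<open>M\<close> over \<open>k\<close>; these are bounded by means of \<open>P(l before i) = f\<^sub>l / (f\<^sub>l + f\<^sub>i)\<close>.

  For (iii), the slot of \<open>i\<close> has mean at most \<open>1 / f\<^sub>i\<close>, and tangent lines of the logarithm at \<open>1 / f\<^sub>i\<close> and
  at the entropy replace Jensen's inequality. The lower bound on OPT is Gibbs' inequality with weights
  proportional to \<open>j powr - (1 + e)\<close>, where \<open>1 / e\<close> is one plus the mean of \<open>log\<^sub>2 j\<close>.
\<close>

section \<open>Size-biased orderings\<close>

text \<open>Expected \<open>f\<close>-weight left over after \<open>k\<close> draws without replacement from \<open>A\<close>, each made with
  probability proportional to \<open>f\<close>.\<close>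

primrec missed :: "('a \<Rightarrow> real) \<Rightarrow> nat \<Rightarrow> 'a set \<Rightarrow> real" where
  "missed f 0 A = sum f A"
| "missed f (Suc k) A = (\<Sum>i\<in>A. f i / sum f A * missed f k (A - {i}))"

text \<open>Mean weight of item number \<open>k + 1\<close> in the random ordering; for finite
  \<open>A\<close> it vanishes once \<open>A\<close> is exhausted.\<close>

definition missed_drop :: "('a \<Rightarrow> real) \<Rightarrow> nat \<Rightarrow> 'a set \<Rightarrow> real" where
  "missed_drop f k A = missed f k A - missed f (Suc k) A"

lemma missed_nonneg:
  assumes "\<And>i. i \<in> A \<Longrightarrow> 0 \<le> f i"
  shows "0 \<le> missed f k A"
  using assms
proof (induction k arbitrary: A)
  case 0
  then show ?case by (simp add: sum_nonneg)
next
  case (Suc k)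
  have "0 \<le> missed f k (A - {i})" for i
    using Suc.prems by (intro Suc.IH) auto
  then show ?case
    using Suc.prems by (simp add: sum_nonneg)
qed

lemma missed_eq_0:
  assumes "finite A" "card A \<le> k"
  shows "missed f k A = 0"
  using assms by (induction k arbitrary: A) (auto simp: card_Diff_singleton)

lemma missed_cong:
  assumes "\<And>i. i \<in> A \<Longrightarrow> f i = g i"
  shows "missed f k A = missed g k A"
  using assms
proof (induction k arbitrary: A)
  case 0
  then show ?case by simp
next
  case (Suc k)
  have "missed f k (A - {i}) = missed g k (A - {i})" for i
    using Suc.prems by (intro Suc.IH) auto
  moreover have "sum f A = sum g A"
    using Suc.prems by (intro sum.cong) auto
  ultimately show ?case
    using Suc.prems by simp
qed

text \<open>Scaling leaves the draw probabilities unchanged, so only the final weight picks up the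
  factor. This passes between frequencies and their normalised \<open>pmf\<close>.\<close>

lemma missed_scale:
  assumes "a \<noteq> 0"
  shows "missed (\<lambda>i. a * f i) k A = a * missed f k A"
  using assms
proof (induction k arbitrary: A)
  case 0
  show ?case by (simp add: sum_distrib_left)
next
  case (Suc k)
  have "missed (\<lambda>i. a * f i) (Suc k) A
      = (\<Sum>i\<in>A. (a * f i) / (a * sum f A) * (a * missed f k (A - {i})))"
    using Suc by (simp add: sum_distrib_left)
  also have "\<dots> = (\<Sum>i\<in>A. a * (f i / sum f A * missed f k (A - {i})))"
    using Suc.prems by (intro sum.cong) auto
  finally show ?case by (simp add: sum_distrib_left)
qed

lemma missed_drop_Suc:
  "missed_drop f (Suc k) A = (\<Sum>i\<in>A. f i / sum f A * missed_drop f k (A - {i}))"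
  unfolding missed_drop_def missed.simps(2)[of f "Suc k"] missed.simps(2)[of f k A]
  by (simp only: right_diff_distrib sum_subtractf)

lemma missed_drop_0:
  assumes "finite A" "0 < sum f A"
  shows "missed_drop f 0 A = (\<Sum>i\<in>A. (f i)\<^sup>2) / sum f A"
proof -
  let ?R = "sum f A"
  have "missed f (Suc 0) A = (\<Sum>i\<in>A. f i - (f i)\<^sup>2 / ?R)"
    using assms by (auto intro!: sum.cong simp: sum_diff1 field_simps power2_eq_square)
  also have "\<dots> = ?R - (\<Sum>i\<in>A. (f i)\<^sup>2) / ?R"
    by (simp add: sum_subtractf sum_divide_distrib)
  finally show ?thesis
    by (simp add: missed_drop_def)
qed

text \<open>A heavy first item tends to leave lighter ones behind. Formally, the difference of the
  two drops is a double sum over (first item, second item), and the terms for \<open>(i, j)\<close>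
  and \<open>(j, i)\<close> add up to something nonpositive.\<close>

lemma missed_drop_1_le:
  assumes fin: "finite A" and pos: "\<And>i. i \<in> A \<Longrightarrow> 0 < f i"
  shows "missed_drop f 1 A \<le> missed_drop f 0 A"
\<comment> \<open>With a single item, \<open>sum f A - f i\<close> would be \<open>0\<close>, and it
  is a divisor in the main case.\<close>
proof (cases "card A \<le> 1")
  case True
  have "0 \<le> missed f 0 A"
    using pos by (intro missed_nonneg less_imp_le)
  with True fin show ?thesis
    by (simp add: missed_drop_def missed_eq_0 del: missed.simps)
next
  case False
  let ?R = "sum f A"
  have R: "0 < ?R"
    using False pos fin by (intro sum_pos) auto
  have diff: "sum f (A - {i}) = ?R - f i" if "i \<in> A" for i
    using fin that by (simp add: sum_diff1)
  have Rpos: "0 < ?R - f i" if "i \<in> A" for i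
  proof -
    have "A - {i} \<noteq> {}"
      using False that fin by (metis Diff_eq_empty_iff One_nat_def card.empty card.insert
        card_mono finite.emptyI finite.insertI equals0D le_less_linear not_less)
    then have "0 < sum f (A - {i})"
      using pos fin by (intro sum_pos) auto
    then show ?thesis by (simp add: diff that)
  qed
  \<comment> \<open>\<open>sum f A\<close> times the probability of drawing \<open>i\<close> first
    and \<open>j\<close> second, times the gain \<open>f j - f i\<close>; it is \<open>0\<close> on
    the diagonal.\<close>
  define T where "T i j = f i * f j * (f j - f i) / (?R - f i)" for i j
  have T_sym: "T i j + T j i \<le> 0" if "i \<in> A" "j \<in> A" for i j
  proof -
    have "T i j + T j i = f i * f j * ((f j - f i) * (1 / (?R - f i) - 1 / (?R - f j)))"
      unfolding T_def
      by (simp add: right_diff_distrib left_diff_distrib diff_divide_distrib mult_ac)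
    moreover have "(f j - f i) * (1 / (?R - f i) - 1 / (?R - f j)) \<le> 0"
    proof (cases "f i \<le> f j")
      case True
      then have "1 / (?R - f i) \<le> 1 / (?R - f j)"
        using Rpos that by (intro divide_left_mono) auto
      with True show ?thesis by (intro mult_nonneg_nonpos) auto
    next
      case False
      then have "1 / (?R - f j) \<le> 1 / (?R - f i)"
        using Rpos that by (intro divide_left_mono) auto
      with False show ?thesis by (intro mult_nonpos_nonneg) auto
    qed
    ultimately show ?thesis
      using pos that by (simp add: mult_nonneg_nonpos less_imp_le)
  qed
  have "2 * (\<Sum>i\<in>A. \<Sum>j\<in>A. T i j) = (\<Sum>i\<in>A. \<Sum>j\<in>A. T i j) + (\<Sum>i\<in>A. \<Sum>j\<in>A. T j i)"
    using sum.swap[of T A A] by simp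
  also have "\<dots> = (\<Sum>i\<in>A. \<Sum>j\<in>A. T i j + T j i)"
    by (simp add: sum.distrib)
  also have "\<dots> \<le> 0"
    using T_sym by (intro sum_nonpos) auto
  finally have T_le: "(\<Sum>i\<in>A. \<Sum>j\<in>A. T i j) \<le> 0" by simp
  have inner: "(\<Sum>j\<in>A. T i j) = f i * missed_drop f 0 (A - {i}) - (f i)\<^sup>2" if i: "i \<in> A" for i
  proof -
    have "(\<Sum>j\<in>A. T i j) = (\<Sum>j\<in>A - {i}. T i j)"
      using fin i by (simp add: sum.remove[of A i] T_def)
    also have "\<dots> = (\<Sum>j\<in>A - {i}. f i * ((f j)\<^sup>2 / (?R - f i)) - (f i)\<^sup>2 / (?R - f i) * f j)"
      by (intro sum.cong refl)
        (simp add: T_def power2_eq_square algebra_simps diff_divide_distrib)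
    also have "\<dots> = f i * ((\<Sum>j\<in>A - {i}. (f j)\<^sup>2) / (?R - f i))
        - (f i)\<^sup>2 / (?R - f i) * sum f (A - {i})"
      by (simp only: sum_subtractf sum_divide_distrib sum_distrib_left)
    also have "(f i)\<^sup>2 / (?R - f i) * sum f (A - {i}) = (f i)\<^sup>2"
      using Rpos[OF i] by (simp add: diff[OF i])
    finally show ?thesis
      using fin Rpos[OF i] by (simp add: missed_drop_0 diff[OF i])
  qed
  have "missed_drop f 1 A - missed_drop f 0 A = (\<Sum>i\<in>A. \<Sum>j\<in>A. T i j) / ?R"
    using fin R
    by (simp add: missed_drop_Suc missed_drop_0 inner sum_subtractf sum_divide_distrib
        diff_divide_distrib)
  also have "\<dots> \<le> 0"
    using T_le R by (intro divide_nonpos_nonneg) auto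
  finally show ?thesis by simp
qed

text \<open>Conditioning on the first draw shifts the comparison of neighbouring draws one place
  down, until it concerns the first two draws.\<close>

lemma missed_drop_Suc_le:
  assumes "finite A" "\<And>i. i \<in> A \<Longrightarrow> 0 < f i"
  shows "missed_drop f (Suc k) A \<le> missed_drop f k A"
  using assms
proof (induction k arbitrary: A)
  case 0
  then show ?case using missed_drop_1_le[of A f] by simp
next
  case (Suc k)
  have "missed_drop f (Suc k) (A - {i}) \<le> missed_drop f k (A - {i})" for i
    using Suc.prems by (intro Suc.IH) auto
  then show ?case
    unfolding missed_drop_Suc[of f "Suc k"] missed_drop_Suc[of f k A]
    using Suc.prems by (intro sum_mono mult_left_mono divide_nonneg_nonneg sum_nonneg)
      (auto intro: less_imp_le)
qed

text \<open>The first \<open>Suc k\<close> drops decrease and telescope to at most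
  \<open>sum f A\<close>, so the last of them is at most their average.\<close>

lemma missed_drop_le:
  assumes fin: "finite A" and pos: "\<And>i. i \<in> A \<Longrightarrow> 0 < f i"
  shows "missed_drop f k A \<le> sum f A / real (Suc k)"
proof -
  have anti: "decseq (\<lambda>k. missed_drop f k A)"
    using missed_drop_Suc_le[OF assms] by (intro decseq_SucI)
  have "real (Suc k) * missed_drop f k A = (\<Sum>j\<le>k. missed_drop f k A)"
    by simp
  also have "\<dots> \<le> (\<Sum>j\<le>k. missed_drop f j A)"
    using decseqD[OF anti] by (intro sum_mono) auto
  also have "\<dots> = missed f 0 A - missed f (Suc k) A"
    unfolding missed_drop_def by (rule sum_telescope)
  also have "\<dots> \<le> sum f A"
    using missed_nonneg[of A f "Suc k"] pos by (simp add: less_imp_le del: missed.simps(2))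
  finally show ?thesis
    by (simp add: field_simps)
qed

text \<open>Induction on \<open>k\<close>, conditioning on the first draw. A draw from
  \<open>A\<close> or from \<open>B\<close> shrinks that set and leaves the other one alone, so the
  induction hypothesis applies in both cases.\<close>

lemma missed_Un_le:
  assumes "finite A" "finite B" "A \<inter> B = {}" "\<And>i. i \<in> A \<union> B \<Longrightarrow> 0 < f i"
  shows "missed f k (A \<union> B) \<le> missed f k A + sum f B * (1 + harm k)"
  using assms
proof (induction k arbitrary: A B)
  case 0
  then show ?case by (simp add: sum.union_disjoint harm_def)
next
  case (Suc k)
  note fin = Suc.prems(1,2) and disj = Suc.prems(3) and pos = Suc.prems(4)
  let ?R = "sum f A" and ?S = "sum f B" and ?h = "1 + harm k :: real"
  have R0: "0 \<le> ?R" and S0: "0 \<le> ?S"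
    using pos by (auto intro!: sum_nonneg simp: less_imp_le)
  have RS: "sum f (A \<union> B) = ?R + ?S"
    using fin disj by (simp add: sum.union_disjoint)
  have h0: "0 \<le> ?h" using harm_nonneg[of k, where 'a=real] by linarith
  show ?case
  proof (cases "A \<union> B = {}")
    case True
    then show ?thesis by simp
  next
    case False
    then have "0 < sum f (A \<union> B)"
      using fin pos by (intro sum_pos) auto
    then have W: "0 < ?R + ?S" by (simp add: RS)
    have stepA: "missed f k ((A \<union> B) - {i}) \<le> missed f k (A - {i}) + ?S * ?h" if "i \<in> A" for i
    proof -
      have "(A \<union> B) - {i} = (A - {i}) \<union> B" using that disj by auto
      then show ?thesis
        using Suc.IH[of "A - {i}" B] fin disj pos by auto
    qed
    have stepB: "missed f k ((A \<union> B) - {i}) \<le> missed f k A + ?S * ?h" if "i \<in> B" for i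
    proof -
      have "(A \<union> B) - {i} = A \<union> (B - {i})" using that disj by auto
      then have "missed f k ((A \<union> B) - {i}) \<le> missed f k A + sum f (B - {i}) * ?h"
        using Suc.IH[of A "B - {i}"] fin disj pos by auto
      also have "sum f (B - {i}) \<le> ?S"
        using fin pos that by (intro sum_mono2) (auto intro: less_imp_le)
      finally show ?thesis using h0 by (simp add: mult_right_mono)
    qed
    have "(?R + ?S) * missed f (Suc k) (A \<union> B) = (\<Sum>i\<in>A \<union> B. f i * missed f k ((A \<union> B) - {i}))"
      using W by (simp add: RS sum_distrib_left)
    also have "\<dots> = (\<Sum>i\<in>A. f i * missed f k ((A \<union> B) - {i})) + (\<Sum>i\<in>B. f i * missed f k ((A \<union> B) - {i}))"
      using fin disj by (rule sum.union_disjoint)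
    also have "\<dots> \<le> (\<Sum>i\<in>A. f i * (missed f k (A - {i}) + ?S * ?h)) + (\<Sum>i\<in>B. f i * (missed f k A + ?S * ?h))"
      using pos by (intro add_mono sum_mono mult_left_mono stepA stepB) (auto intro: less_imp_le)
    also have "\<dots> = (\<Sum>i\<in>A. f i * missed f k (A - {i})) + ?S * missed f k A + (?R + ?S) * (?S * ?h)"
      by (simp add: distrib_left distrib_right sum.distrib sum_distrib_right)
    also have "(\<Sum>i\<in>A. f i * missed f k (A - {i})) = ?R * missed f (Suc k) A"
    proof (cases "A = {}")
      case False
      then have "0 < ?R" using fin pos by (intro sum_pos) auto
      then show ?thesis by (simp add: sum_distrib_left)
    qed simp
    \<comment> \<open>A draw from \<open>B\<close> uses up a draw without removing anything from
      \<open>A\<close>, so \<open>A\<close> is charged \<open>missed f k A\<close> in place of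
      \<open>missed f (Suc k) A\<close>. The excess is one \<open>missed_drop\<close>.\<close>
    also have "?R * missed f (Suc k) A + ?S * missed f k A + (?R + ?S) * (?S * ?h)
        = (?R + ?S) * (missed f (Suc k) A + ?S * ?h) + ?S * missed_drop f k A"
      by (simp add: missed_drop_def algebra_simps del: missed.simps)
    \<comment> \<open>After division by the total weight, the excess is at most
      \<open>?S / real (Suc k)\<close>: the next harmonic term.\<close>
    also have "?S * missed_drop f k A \<le> ?S * (sum f (A \<union> B) / real (Suc k))"
    proof (intro mult_left_mono S0)
      have "missed_drop f k A \<le> ?R / real (Suc k)"
        using fin pos by (intro missed_drop_le) auto
      also have "\<dots> \<le> sum f (A \<union> B) / real (Suc k)"
        using S0 by (simp add: RS divide_right_mono)
      finally show "missed_drop f k A \<le> sum f (A \<union> B) / real (Suc k)" .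
    qed
    finally have "(?R + ?S) * missed f (Suc k) (A \<union> B)
        \<le> (?R + ?S) * (missed f (Suc k) A + ?S * (1 + harm (Suc k)))"
      by (simp add: RS harm_Suc algebra_simps inverse_eq_divide del: missed.simps)
    then show ?thesis
      using W by (simp del: missed.simps)
  qed
qed

section \<open>First-step analysis of the request stream\<close>

text \<open>No first occurrence is mentioned, so the relation makes sense on every stream; where
  \<open>i\<close> never occurs, every requested item counts as earlier.\<close>

definition requested_before :: "'a stream \<Rightarrow> 'a \<Rightarrow> 'a \<Rightarrow> bool" where
  "requested_before \<omega> l i \<longleftrightarrow> (\<exists>t. \<omega> !! t = l \<and> (\<forall>u\<le>t. \<omega> !! u \<noteq> i))"

text \<open>The set \<open>U\<close> is a parameter because a request for an item of
  \<open>U\<close> removes it from the set still to be counted; this closes the first-step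
  recursion.\<close>

definition num_before :: "'a set \<Rightarrow> 'a stream \<Rightarrow> 'a \<Rightarrow> nat" where
  "num_before U \<omega> i = card {l \<in> U. requested_before \<omega> l i}"

lemma requested_before_SCons:
  "requested_before (x ## \<omega>) l i \<longleftrightarrow> x \<noteq> i \<and> (x = l \<or> requested_before \<omega> l i)"
proof
  assume "requested_before (x ## \<omega>) l i"
  then obtain t where t: "(x ## \<omega>) !! t = l" "\<And>u. u \<le> t \<Longrightarrow> (x ## \<omega>) !! u \<noteq> i"
    unfolding requested_before_def by blast
  have "x \<noteq> i" using t(2)[of 0] by simp
  moreover have "x = l \<or> requested_before \<omega> l i"
  proof (cases t)
    case (Suc v)
    then have "\<omega> !! v = l" using t(1) by simp
    moreover have "\<omega> !! u \<noteq> i" if "u \<le> v" for u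
      using t(2)[of "Suc u"] that Suc by simp
    ultimately show ?thesis unfolding requested_before_def by blast
  qed (use t in simp)
  ultimately show "x \<noteq> i \<and> (x = l \<or> requested_before \<omega> l i)" ..
next
  assume R: "x \<noteq> i \<and> (x = l \<or> requested_before \<omega> l i)"
  show "requested_before (x ## \<omega>) l i"
  proof (cases "x = l")
    case True
    with R show ?thesis
      unfolding requested_before_def by (intro exI[of _ 0]) auto
  next
    case False
    with R obtain t where t: "\<omega> !! t = l" "\<And>u. u \<le> t \<Longrightarrow> \<omega> !! u \<noteq> i"
      unfolding requested_before_def by blast
    have "(x ## \<omega>) !! u \<noteq> i" if "u \<le> Suc t" for u
      using that R t(2) by (cases u) auto
    with t(1) show ?thesis
      unfolding requested_before_def by (intro exI[of _ "Suc t"]) auto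
  qed
qed

lemma not_requested_before_self: "\<not> requested_before \<omega> i i"
  by (auto simp: requested_before_def)

lemma num_before_SCons:
  assumes "finite U"
  shows "num_before U (x ## \<omega>) i =
    (if x = i then 0 else if x \<in> U then Suc (num_before (U - {x}) \<omega> i) else num_before U \<omega> i)"
proof -
  have "{l \<in> U. requested_before (x ## \<omega>) l i} = insert x {l \<in> U - {x}. requested_before \<omega> l i}"
    if "x \<noteq> i" "x \<in> U"
    using that by (auto simp: requested_before_SCons)
  moreover have "{l \<in> U. requested_before (x ## \<omega>) l i} = {l \<in> U. requested_before \<omega> l i}"
    if "x \<noteq> i" "x \<notin> U"
    using that by (auto simp: requested_before_SCons)
  ultimately show ?thesis
    using assms by (auto simp: num_before_def requested_before_SCons)
qed

lemma num_before_eq_sum: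
  assumes "finite U"
  shows "num_before U \<omega> i = (\<Sum>l\<in>U - {i}. if requested_before \<omega> l i then 1 else 0)"
proof -
  have "{l \<in> U. requested_before \<omega> l i} = (U - {i}) \<inter> {l. requested_before \<omega> l i}"
    by (auto simp: not_requested_before_self)
  then show ?thesis
    using assms by (simp add: num_before_def sum.If_cases)
qed

section \<open>Order probabilities in an i.i.d. stream with finite support\<close>

locale request_stream =
  fixes p :: "nat pmf"
  assumes finite_support: "finite (set_pmf p)"
begin

abbreviation S :: "nat stream measure" where
  "S \<equiv> stream_space (measure_pmf p)"

sublocale S: prob_space S
  by (intro prob_space.prob_space_stream_space measure_pmf.prob_space_axioms)

lemma space_S [simp]: "space S = UNIV"
  by (simp add: space_stream_space)

lemma measurable_snth_count_space [measurable]: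
  "(\<lambda>\<omega>. \<omega> !! t) \<in> measurable S (count_space UNIV)"
  using measurable_snth[of t "measure_pmf p"] by simp

lemma measurable_requested_before [measurable]: "Measurable.pred S (\<lambda>\<omega>. requested_before \<omega> l i)"
  unfolding requested_before_def by measurable

lemma measurable_num_before [measurable]:
  "(\<lambda>\<omega>. num_before U \<omega> i) \<in> measurable S (count_space UNIV)" if "finite U"
  unfolding num_before_eq_sum[OF that] by measurable

lemma num_before_ge_in_sets: "{\<omega>. k \<le> num_before U \<omega> i} \<in> sets S" if "finite U"
proof -
  note [measurable] = measurable_num_before[OF that]
  have "{\<omega> \<in> space S. k \<le> num_before U \<omega> i} \<in> sets S" by measurable
  then show ?thesis by simp
qed

lemma prob_first_step:
  assumes X: "X \<in> sets S"
  shows "S.prob X = (\<Sum>x\<in>set_pmf p. pmf p x * S.prob {\<omega>. x ## \<omega> \<in> X})"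
proof -
  have "emeasure S X = (\<integral>\<^sup>+x. emeasure S {\<omega>. x ## \<omega> \<in> X} \<partial>measure_pmf p)"
    using prob_space.emeasure_stream_space[OF measure_pmf.prob_space_axioms X] by simp
  also have "\<dots> = (\<Sum>x\<in>set_pmf p. emeasure S {\<omega>. x ## \<omega> \<in> X} * pmf p x)"
    by (intro nn_integral_measure_pmf_finite finite_support) simp
  also have "\<dots> = (\<Sum>x\<in>set_pmf p. ennreal (pmf p x * S.prob {\<omega>. x ## \<omega> \<in> X}))"
    by (intro sum.cong refl) (simp add: S.emeasure_eq_measure ennreal_mult mult.commute)
  also have "\<dots> = ennreal (\<Sum>x\<in>set_pmf p. pmf p x * S.prob {\<omega>. x ## \<omega> \<in> X})"
    by (intro sum_ennreal) simp
  finally show ?thesis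
    by (simp add: S.emeasure_eq_measure sum_nonneg)
qed

lemma sum_pmf_support: "(\<Sum>x\<in>set_pmf p. pmf p x) = 1"
  using finite_support by (intro sum_pmf_eq_1) auto

text \<open>The probability \<open>P\<close> that \<open>i\<close> never occurs satisfies
  \<open>P = (1 - pmf p i) * P\<close>.\<close>

lemma AE_requested:
  assumes i: "i \<in> set_pmf p"
  shows "AE \<omega> in S. \<exists>t. \<omega> !! t = i"
proof -
  let ?X = "{\<omega>. \<forall>t. \<omega> !! t \<noteq> i}"
  have "{\<omega> \<in> space S. \<forall>t. \<omega> !! t \<noteq> i} \<in> sets S" by measurable
  then have X: "?X \<in> sets S" by simp
  have *: "{\<omega>. x ## \<omega> \<in> ?X} = (if x = i then {} else ?X)" for x
    by (auto simp: Stream_snth split: nat.splits)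
  have "S.prob ?X = (\<Sum>x\<in>set_pmf p. pmf p x * S.prob (if x = i then {} else ?X))"
    by (subst prob_first_step[OF X]) (simp only: *)
  also have "\<dots> = (\<Sum>x\<in>set_pmf p - {i}. pmf p x * S.prob ?X)"
    using i finite_support by (subst sum.remove[of _ i]) (auto intro!: sum.cong)
  also have "\<dots> = (1 - pmf p i) * S.prob ?X"
    using i finite_support by (simp add: sum_diff1 sum_pmf_support flip: sum_distrib_right)
  finally have "pmf p i * S.prob ?X = 0" by (simp add: algebra_simps)
  then have "S.prob ?X = 0"
    using i by (simp add: set_pmf_iff)
  then have "AE \<omega> in S. \<omega> \<notin> ?X"
    using X by (simp add: S.prob_eq_0)
  then show ?thesis by simp
qed

text \<open>A first request for \<open>l\<close> or \<open>i\<close> decides the order and any other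
  changes nothing, so the probability \<open>P\<close> satisfies
  \<open>P = pmf p l + (1 - pmf p i - pmf p l) * P\<close>.\<close>

lemma prob_requested_before:
  assumes "l \<in> set_pmf p" "i \<in> set_pmf p" "l \<noteq> i"
  shows "S.prob {\<omega>. requested_before \<omega> l i} = pmf p l / (pmf p l + pmf p i)"
proof -
  let ?X = "{\<omega>. requested_before \<omega> l i}"
  have "{\<omega> \<in> space S. requested_before \<omega> l i} \<in> sets S" by measurable
  then have X: "?X \<in> sets S" by simp
  have *: "{\<omega>. x ## \<omega> \<in> ?X} = (if x = i then {} else if x = l then UNIV else ?X)" for x
    by (auto simp: requested_before_SCons)
  have rest: "(\<Sum>x\<in>set_pmf p - {i} - {l}. pmf p x) = 1 - pmf p i - pmf p l"
    using assms finite_support by (simp add: sum_diff1 sum_pmf_support)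
  have "S.prob ?X
      = (\<Sum>x\<in>set_pmf p. pmf p x * S.prob (if x = i then {} else if x = l then UNIV else ?X))"
    by (subst prob_first_step[OF X]) (simp only: *)
  also have "\<dots> = pmf p l + (\<Sum>x\<in>set_pmf p - {i} - {l}. pmf p x * S.prob ?X)"
    using assms finite_support S.prob_space
    by (simp add: sum.remove[of _ i] sum.remove[of _ l])
  also have "\<dots> = pmf p l + (1 - pmf p i - pmf p l) * S.prob ?X"
    by (simp add: rest flip: sum_distrib_right)
  finally have "(pmf p l + pmf p i) * S.prob ?X = pmf p l" by (simp add: algebra_simps)
  moreover have "0 < pmf p l + pmf p i"
    using assms by (simp add: pmf_positive add_pos_pos)
  ultimately show ?thesis by (simp add: field_simps)
qed

text \<open>First requests outside \<open>U\<close> reproduce the event, and moving their share to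
  the left leaves the factor \<open>sum (pmf p) U\<close>. A first request for \<open>i\<close>
  rules the event out; any other \<open>x\<close> in \<open>U\<close> supplies one predecessor and
  leaves \<open>U - {x}\<close>.\<close>

lemma prob_num_before_ge_Suc:
  assumes U: "U \<subseteq> set_pmf p" and i: "i \<in> U"
  shows "sum (pmf p) U * S.prob {\<omega>. Suc k \<le> num_before U \<omega> i}
    = (\<Sum>x\<in>U - {i}. pmf p x * S.prob {\<omega>. k \<le> num_before (U - {x}) \<omega> i})"
proof -
  have fin: "finite U" using U finite_support by (rule finite_subset)
  let ?X = "{\<omega>. Suc k \<le> num_before U \<omega> i}"
  let ?q = "\<lambda>x. S.prob {\<omega>. x ## \<omega> \<in> ?X}"
  have outside: "?q x = S.prob ?X" if "x \<notin> U" for x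
  proof -
    have "x \<noteq> i" using that i by blast
    with that fin show ?thesis by (simp add: num_before_SCons)
  qed
  have inside: "?q x = S.prob {\<omega>. k \<le> num_before (U - {x}) \<omega> i}" if "x \<in> U - {i}" for x
    using that fin by (simp add: num_before_SCons)
  have self: "?q i = 0"
    using fin by (simp add: num_before_SCons)
  have "S.prob ?X = (\<Sum>x\<in>set_pmf p. pmf p x * ?q x)"
    by (rule prob_first_step) (rule num_before_ge_in_sets[OF fin])
  also have "\<dots> = (\<Sum>x\<in>set_pmf p - U. pmf p x * ?q x) + (\<Sum>x\<in>U. pmf p x * ?q x)"
    using U finite_support by (rule sum.subset_diff)
  also have "(\<Sum>x\<in>set_pmf p - U. pmf p x * ?q x) = (\<Sum>x\<in>set_pmf p - U. pmf p x) * S.prob ?X"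
    unfolding sum_distrib_right by (intro sum.cong refl) (use outside in auto)
  also have "(\<Sum>x\<in>set_pmf p - U. pmf p x) = 1 - sum (pmf p) U"
    using U finite_support by (simp add: sum_diff sum_pmf_support)
  also have "(\<Sum>x\<in>U. pmf p x * ?q x) = (\<Sum>x\<in>U - {i}. pmf p x * ?q x)"
    using fin i self by (simp add: sum.remove[of U i])
  also have "\<dots> = (\<Sum>x\<in>U - {i}. pmf p x * S.prob {\<omega>. k \<le> num_before (U - {x}) \<omega> i})"
    by (intro sum.cong refl) (simp only: inside)
  finally show ?thesis by (simp add: algebra_simps)
qed

text \<open>An item is missing from the first \<open>k\<close> distinct requests out of
  \<open>U\<close> exactly if at least \<open>k\<close> items of \<open>U\<close> precede it.
  Requests outside \<open>U\<close> do not affect this order, so both sides obey the recursion of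
  draws without replacement.\<close>

lemma missed_eq_prob:
  assumes "U \<subseteq> set_pmf p"
  shows "missed (pmf p) k U = (\<Sum>i\<in>U. pmf p i * S.prob {\<omega>. k \<le> num_before U \<omega> i})"
  using assms
proof (induction k arbitrary: U)
  case 0
  show ?case using S.prob_space by simp
next
  case (Suc k)
  let ?R = "sum (pmf p) U"
  have fin: "finite U" using Suc.prems finite_support by (rule finite_subset)
  show ?case
  proof (cases "U = {}")
    case False
    then have R: "0 < ?R"
      using Suc.prems fin by (intro sum_pos) (auto simp: pmf_positive)
    have "?R * missed (pmf p) (Suc k) U = (\<Sum>x\<in>U. pmf p x * missed (pmf p) k (U - {x}))"
      using R by (simp add: sum_distrib_left)
    also have "\<dots> = (\<Sum>x\<in>U. \<Sum>i\<in>U - {x}. pmf p x * (pmf p i * S.prob {\<omega>. k \<le> num_before (U - {x}) \<omega> i}))"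
    proof (intro sum.cong refl)
      fix x assume "x \<in> U"
      have "missed (pmf p) k (U - {x}) = (\<Sum>i\<in>U - {x}. pmf p i * S.prob {\<omega>. k \<le> num_before (U - {x}) \<omega> i})"
        using Suc.prems by (intro Suc.IH) auto
      then show "pmf p x * missed (pmf p) k (U - {x})
          = (\<Sum>i\<in>U - {x}. pmf p x * (pmf p i * S.prob {\<omega>. k \<le> num_before (U - {x}) \<omega> i}))"
        by (simp add: sum_distrib_left)
    qed
    also have "\<dots> = (\<Sum>i\<in>U. \<Sum>x\<in>U - {i}. pmf p x * (pmf p i * S.prob {\<omega>. k \<le> num_before (U - {x}) \<omega> i}))"
    proof -
      have "(\<Sum>x\<in>U. \<Sum>i\<in>U - {x}. g x i) = (\<Sum>i\<in>U. \<Sum>x\<in>U - {i}. g x i)"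
        for g :: "nat \<Rightarrow> nat \<Rightarrow> real"
      proof -
        \<comment> \<open>The inner range depends on the outer index, so the exchange goes through
          sums over all of \<open>U\<close> with a zero on the diagonal.\<close>
        have "(\<Sum>i\<in>U - {x}. h i) = (\<Sum>i\<in>U. if i = x then 0 else h i)" for x and h :: "nat \<Rightarrow> real"
          using fin by (intro sum.mono_neutral_cong_left) auto
        then show ?thesis
          by (simp only:) (subst sum.swap, intro sum.cong refl, auto)
      qed
      then show ?thesis .
    qed
    also have "\<dots> = (\<Sum>i\<in>U. pmf p i * (\<Sum>x\<in>U - {i}. pmf p x * S.prob {\<omega>. k \<le> num_before (U - {x}) \<omega> i}))"
      by (simp add: sum_distrib_left mult_ac)
    also have "\<dots> = (\<Sum>i\<in>U. pmf p i * (?R * S.prob {\<omega>. Suc k \<le> num_before U \<omega> i}))"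
      by (intro sum.cong refl) (simp only: prob_num_before_ge_Suc[OF Suc.prems])
    also have "\<dots> = ?R * (\<Sum>i\<in>U. pmf p i * S.prob {\<omega>. Suc k \<le> num_before U \<omega> i})"
      by (simp add: sum_distrib_left mult_ac)
    finally show ?thesis using R by simp
  qed simp
qed

lemma integrable_num_before: "integrable S (\<lambda>\<omega>. real (num_before U \<omega> i))" if "finite U"
proof (rule S.integrable_const_bound)
  note [measurable] = measurable_num_before[OF that]
  show "(\<lambda>\<omega>. real (num_before U \<omega> i)) \<in> borel_measurable S" by measurable
  show "AE \<omega> in S. norm (real (num_before U \<omega> i)) \<le> real (card U)"
    unfolding num_before_def using that by (intro AE_I2) (auto intro!: card_mono)
qed

lemma expectation_num_before:
  assumes "U \<subseteq> set_pmf p" "i \<in> U"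
  shows "S.expectation (\<lambda>\<omega>. real (num_before U \<omega> i))
    = (\<Sum>l\<in>U - {i}. pmf p l / (pmf p l + pmf p i))"
proof -
  have fin: "finite U" using assms(1) finite_support by (rule finite_subset)
  have ev: "{\<omega>. requested_before \<omega> l i} \<in> sets S" for l
  proof -
    have "{\<omega> \<in> space S. requested_before \<omega> l i} \<in> sets S" by measurable
    then show ?thesis by simp
  qed
  have int: "integrable S (indicator {\<omega>. requested_before \<omega> l i} :: _ \<Rightarrow> real)" for l
    using ev by (intro integrable_real_indicator) (auto simp: S.emeasure_eq_measure)
  have "S.expectation (\<lambda>\<omega>. real (num_before U \<omega> i))
      = S.expectation (\<lambda>\<omega>. \<Sum>l\<in>U - {i}. indicator {\<omega>. requested_before \<omega> l i} \<omega>)"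
    by (intro Bochner_Integration.integral_cong refl)
      (auto simp: num_before_eq_sum[OF fin] indicator_def intro!: sum.cong split: if_splits)
  also have "\<dots> = (\<Sum>l\<in>U - {i}. S.prob {\<omega>. requested_before \<omega> l i})"
    using int by (subst Bochner_Integration.integral_sum) auto
  also have "\<dots> = (\<Sum>l\<in>U - {i}. pmf p l / (pmf p l + pmf p i))"
    using assms by (intro sum.cong prob_requested_before) auto
  finally show ?thesis .
qed

text \<open>Tail-sum formula for the mean, cut off at \<open>m\<close>.\<close>

lemma sum_prob_num_before_ge_le:
  assumes "finite U"
  shows "(\<Sum>k=1..m. S.prob {\<omega>. k \<le> num_before U \<omega> i}) \<le> S.expectation (\<lambda>\<omega>. real (num_before U \<omega> i))"
proof -
  note ev = num_before_ge_in_sets[OF assms]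
  have int: "integrable S (indicator {\<omega>. k \<le> num_before U \<omega> i} :: _ \<Rightarrow> real)" for k
    using ev by (intro integrable_real_indicator) (auto simp: S.emeasure_eq_measure)
  have "(\<Sum>k=1..m. S.prob {\<omega>. k \<le> num_before U \<omega> i})
      = S.expectation (\<lambda>\<omega>. \<Sum>k=1..m. indicator {\<omega>. k \<le> num_before U \<omega> i} \<omega>)"
    using int by (subst Bochner_Integration.integral_sum) auto
  also have "\<dots> \<le> S.expectation (\<lambda>\<omega>. real (num_before U \<omega> i))"
  proof (rule integral_mono)
    show "integrable S (\<lambda>\<omega>. \<Sum>k=1..m. indicator {\<omega>. k \<le> num_before U \<omega> i} \<omega> :: real)"
      using int by (intro Bochner_Integration.integrable_sum)
    fix \<omega>
    have "(\<Sum>k=1..m. indicator {\<omega>. k \<le> num_before U \<omega> i} \<omega> :: real)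
        = real (card ({1..m} \<inter> {k. k \<le> num_before U \<omega> i}))"
      by (simp add: indicator_def sum.If_cases)
    also have "\<dots> \<le> real (card {1..num_before U \<omega> i})"
      by (intro of_nat_mono card_mono) auto
    finally show "(\<Sum>k=1..m. indicator {\<omega>. k \<le> num_before U \<omega> i} \<omega>) \<le> real (num_before U \<omega> i)"
      by simp
  qed (rule integrable_num_before[OF assms])
  finally show ?thesis .
qed

end

section \<open>Cost as a combination of thresholds\<close>

text \<open>The history ends with the first request for \<open>i\<close>, so its distinct items are
  the predecessors of \<open>i\<close> and \<open>i\<close> itself; the latter accounts for
  \<open>Suc\<close>.\<close>

lemma slot_of_fcfs:
  assumes "\<And>t. \<omega> !! t \<in> {1..n}" and "\<exists>t. \<omega> !! t = i"
  shows "slot_of fcfs n c \<omega> i = Suc (num_before {1..n} \<omega> i)"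
proof -
  define T where "T = first_request \<omega> i"
  have T: "\<omega> !! T = i"
    unfolding T_def first_request_def using assms(2) by (rule LeastI_ex)
  have before_T: "\<omega> !! u \<noteq> i" if "u < T" for u
    using that unfolding T_def first_request_def by (rule not_less_Least)
  have iff: "requested_before \<omega> l i \<longleftrightarrow> (\<exists>t<T. \<omega> !! t = l)" for l
  proof
    assume "requested_before \<omega> l i"
    then obtain t where t: "\<omega> !! t = l" "\<And>u. u \<le> t \<Longrightarrow> \<omega> !! u \<noteq> i"
      unfolding requested_before_def by blast
    then have "t < T" using T not_less[of t T] by blast
    with t show "\<exists>t<T. \<omega> !! t = l" by blast
  next
    assume "\<exists>t<T. \<omega> !! t = l"
    then obtain t where t: "t < T" "\<omega> !! t = l" by blast
    then have "\<omega> !! u \<noteq> i" if "u \<le> t" for u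
      using before_T[of u] that by simp
    with t(2) show "requested_before \<omega> l i"
      unfolding requested_before_def by blast
  qed
  have "set (stake (Suc T) \<omega>) = insert i (set (stake T \<omega>))"
    using T by (simp add: stake_Suc del: stake.simps)
  also have "set (stake T \<omega>) = {l \<in> {1..n}. requested_before \<omega> l i}"
    unfolding iff using assms(1) by (force simp: in_set_conv_nth stake_nth)
  finally show ?thesis
    unfolding slot_of_def fcfs_def num_before_def T_def[symmetric]
    by (simp add: not_requested_before_self del: stake.simps)
qed

lemma num_before_less:
  assumes "i \<in> {1..n}"
  shows "num_before {1..n} \<omega> i < n"
proof -
  have "num_before {1..n} \<omega> i \<le> card ({1..n} - {i})"
    unfolding num_before_def by (intro card_mono) (auto simp: not_requested_before_self)
  also have "\<dots> < n" using assms by simp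
  finally show ?thesis .
qed

lemma sum_f_pos: "osa_instance n f c \<Longrightarrow> 0 < (\<Sum>i=1..n. f i)"
  by (intro sum_pos) (auto simp: osa_instance_def)

lemma set_request_pmf:
  assumes "osa_instance n f c"
  shows "set_pmf (request_pmf n f) = {1..n}"
  using assms sum_f_pos[OF assms]
  by (force simp: set_pmf_eq pmf_request_pmf[OF assms] osa_instance_def)

lemma request_stream_request_pmf: "osa_instance n f c \<Longrightarrow> request_stream (request_pmf n f)"
  by unfold_locales (simp add: set_request_pmf)

lemma AE_slot_of_fcfs:
  assumes "osa_instance n f c"
  shows "AE \<omega> in request_space n f. \<forall>i\<in>{1..n}. slot_of fcfs n c \<omega> i = Suc (num_before {1..n} \<omega> i)"
proof -
  interpret request_stream "request_pmf n f"
    using assms by (rule request_stream_request_pmf)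
  have "AE \<omega> in S. stream_all (\<lambda>x. x \<in> {1..n}) \<omega>"
    by (intro prob_space.AE_stream_all measure_pmf.prob_space_axioms)
      (auto simp: AE_measure_pmf_iff set_request_pmf[OF assms])
  moreover have "AE \<omega> in S. \<forall>i\<in>{1..n}. \<exists>t. \<omega> !! t = i"
    using AE_requested by (intro AE_finite_allI) (auto simp: set_request_pmf[OF assms])
  ultimately show ?thesis
    unfolding request_space_def
  proof eventually_elim
    case (elim \<omega>)
    then have "\<omega> !! t \<in> {1..n}" for t
      by (auto simp: stream.pred_set sset_range)
    with elim(2) show ?case
      by (intro ballI slot_of_fcfs) auto
  qed
qed

lemma cost_eq_sum_increments:
  fixes c :: "nat \<Rightarrow> real"
  assumes "1 \<le> j" "j \<le> n"
  shows "c j = c 1 + (\<Sum>k=1..<n. (c (Suc k) - c k) * (if k < j then 1 else 0))"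
proof -
  have "(\<Sum>k=1..<n. (c (Suc k) - c k) * (if k < j then 1 else 0)) = (\<Sum>k=1..<j. c (Suc k) - c k)"
    using assms by (intro sum.mono_neutral_cong_right) auto
  also have "\<dots> = c j - c 1"
    using assms(1) by (rule sum_Suc_diff')
  finally show ?thesis by simp
qed

lemma assignment_cost_increments:
  assumes "\<And>i. i \<in> {1..n} \<Longrightarrow> s i \<in> {1..n}"
  shows "assignment_cost n f c s
    = c 1 * (\<Sum>i=1..n. f i) + (\<Sum>k=1..<n. (c (Suc k) - c k) * sum f {i \<in> {1..n}. k < s i})"
proof -
  have "assignment_cost n f c s
      = (\<Sum>i=1..n. f i * (c 1 + (\<Sum>k=1..<n. (c (Suc k) - c k) * (if k < s i then 1 else 0))))"
    unfolding assignment_cost_def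
    by (intro sum.cong refl arg_cong2[where f="(*)"] cost_eq_sum_increments) (use assms in auto)
  also have "\<dots> = c 1 * (\<Sum>i=1..n. f i)
      + (\<Sum>i=1..n. \<Sum>k=1..<n. (c (Suc k) - c k) * (if k < s i then f i else 0))"
    by (simp add: distrib_left sum.distrib sum_distrib_left mult_ac if_distrib cong: if_cong)
  also have "(\<Sum>i=1..n. \<Sum>k=1..<n. (c (Suc k) - c k) * (if k < s i then f i else 0))
      = (\<Sum>k=1..<n. (c (Suc k) - c k) * (\<Sum>i=1..n. if k < s i then f i else 0))"
    by (subst sum.swap) (simp add: sum_distrib_left)
  also have "\<dots> = (\<Sum>k=1..<n. (c (Suc k) - c k) * sum f {i \<in> {1..n}. k < s i})"
    by (simp only: sum.inter_filter finite_atLeastAtMost)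
  finally show ?thesis .
qed

lemma missed_eq_sum_prob:
  assumes "osa_instance n f c"
  shows "missed f k {1..n}
    = (\<Sum>i=1..n. f i * measure (request_space n f) {\<omega>. k \<le> num_before {1..n} \<omega> i})"
proof -
  interpret request_stream "request_pmf n f"
    using assms by (rule request_stream_request_pmf)
  let ?F = "\<Sum>i=1..n. f i" and ?p = "pmf (request_pmf n f)"
  have f: "f i = ?F * ?p i" if "i \<in> {1..n}" for i
    using sum_f_pos[OF assms] that by (simp add: pmf_request_pmf[OF assms])
  have "missed f k {1..n} = missed (\<lambda>i. ?F * ?p i) k {1..n}"
    by (rule missed_cong) (rule f)
  also have "\<dots> = ?F * missed ?p k {1..n}"
    using sum_f_pos[OF assms] by (intro missed_scale) simp
  also have "\<dots> = (\<Sum>i=1..n. ?F * ?p i * measure S {\<omega>. k \<le> num_before {1..n} \<omega> i})"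
    unfolding missed_eq_prob[OF equalityD2[OF set_request_pmf[OF assms]]]
    by (simp only: sum_distrib_left mult.assoc)
  also have "\<dots> = (\<Sum>i=1..n. f i * measure S {\<omega>. k \<le> num_before {1..n} \<omega> i})"
    by (intro sum.cong refl) (simp only: f[symmetric])
  finally show ?thesis unfolding request_space_def .
qed

text \<open>An item pays the increment \<open>c (Suc k) - c k\<close> exactly if its slot exceeds
  \<open>k\<close>, that is, if at least \<open>k\<close> items precede it. The expected weight of
  these items is \<open>missed f k {1..n}\<close>.\<close>

lemma expected_cost_fcfs:
  assumes "osa_instance n f c"
  shows "expected_cost fcfs n f c
    = c 1 * (\<Sum>i=1..n. f i) + (\<Sum>k=1..<n. (c (Suc k) - c k) * missed f k {1..n})"
proof -
  interpret request_stream "request_pmf n f"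
    using assms by (rule request_stream_request_pmf)
  let ?X = "\<lambda>k i. {\<omega>. k \<le> num_before {1..n} \<omega> i}"
  let ?Y = "\<lambda>\<omega>. c 1 * (\<Sum>i=1..n. f i)
      + (\<Sum>k=1..<n. (c (Suc k) - c k) * (\<Sum>i=1..n. f i * indicator (?X k i) \<omega>))"
  have X: "?X k i \<in> sets S" for k i by (rule num_before_ge_in_sets) simp
  have int: "integrable S (indicator (?X k i) :: _ \<Rightarrow> real)" for k i
    using X by (intro integrable_real_indicator) (auto simp: S.emeasure_eq_measure)
  have inner: "integrable S (\<lambda>\<omega>. (c (Suc k) - c k) * (\<Sum>i=1..n. f i * indicator (?X k i) \<omega>))" for k
    using int by (intro integrable_mult_right Bochner_Integration.integrable_sum)
  then have outer: "integrable S
      (\<lambda>\<omega>. \<Sum>k=1..<n. (c (Suc k) - c k) * (\<Sum>i=1..n. f i * indicator (?X k i) \<omega>))"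
    by (rule Bochner_Integration.integrable_sum)
  then have intY: "integrable S ?Y"
    by (intro Bochner_Integration.integrable_add) simp_all
  have "AE \<omega> in S. assignment_cost n f c (slot_of fcfs n c \<omega>) = ?Y \<omega>"
    using AE_slot_of_fcfs[OF assms] unfolding request_space_def
  proof eventually_elim
    case (elim \<omega>)
    have slot: "slot_of fcfs n c \<omega> i \<in> {1..n}" if "i \<in> {1..n}" for i
      using elim num_before_less[OF that, of \<omega>] that by auto
    have "sum f {i \<in> {1..n}. k < slot_of fcfs n c \<omega> i}
        = (\<Sum>i=1..n. f i * indicator (?X k i) \<omega>)" for k
      unfolding sum.inter_filter[OF finite_atLeastAtMost]
    proof (intro sum.cong refl)
      fix i assume "i \<in> {1..n}"
      with elim have "slot_of fcfs n c \<omega> i = Suc (num_before {1..n} \<omega> i)" by blast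
      then show "(if k < slot_of fcfs n c \<omega> i then f i else 0) = f i * indicator (?X k i) \<omega>"
        by (simp add: less_Suc_eq_le)
    qed
    then show ?case
      by (simp only: assignment_cost_increments[OF slot])
  qed
  then have "expected_cost fcfs n f c = (\<integral>\<omega>. ?Y \<omega> \<partial>S)"
    unfolding expected_cost_def request_space_def
    using measurable_assignment_cost[of n f c fcfs, unfolded request_space_def]
      borel_measurable_integrable[OF intY] by (intro integral_cong_AE)
  also have "\<dots> = c 1 * (\<Sum>i=1..n. f i)
      + (\<Sum>k=1..<n. (c (Suc k) - c k) * (\<Sum>i=1..n. f i * S.prob (?X k i)))"
  proof -
    have "(\<integral>\<omega>. ?Y \<omega> \<partial>S) = c 1 * (\<Sum>i=1..n. f i)
        + (\<integral>\<omega>. (\<Sum>k=1..<n. (c (Suc k) - c k) * (\<Sum>i=1..n. f i * indicator (?X k i) \<omega>)) \<partial>S)"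
      using outer S.prob_space by (subst Bochner_Integration.integral_add) simp_all
    also have "(\<integral>\<omega>. (\<Sum>k=1..<n. (c (Suc k) - c k) * (\<Sum>i=1..n. f i * indicator (?X k i) \<omega>)) \<partial>S)
        = (\<Sum>k=1..<n. \<integral>\<omega>. (c (Suc k) - c k) * (\<Sum>i=1..n. f i * indicator (?X k i) \<omega>) \<partial>S)"
      using inner by (rule Bochner_Integration.integral_sum)
    also have "\<dots> = (\<Sum>k=1..<n. (c (Suc k) - c k) * (\<Sum>i=1..n. f i * S.prob (?X k i)))"
      using int X by (simp only: integral_mult_right_zero
          Bochner_Integration.integral_sum[OF integrable_mult_right]
          Bochner_Integration.integral_indicator space_S Int_UNIV_right real_scaleR_def)
    finally show ?thesis .
  qed
  finally show ?thesis
    unfolding missed_eq_sum_prob[OF assms] request_space_def .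
qed

section \<open>The harmonic bound for general costs\<close>

lemma card_permutes_le:
  assumes "s permutes {1..n}" "k \<le> n"
  shows "card {i \<in> {1..n}. s i \<le> k} = k"
proof -
  have "s ` {i \<in> {1..n}. s i \<le> k} = {1..k}"
  proof (intro subset_antisym subsetI)
    fix j assume j: "j \<in> {1..k}"
    then have "j \<in> s ` {1..n}"
      using assms by (simp add: permutes_image)
    then show "j \<in> s ` {i \<in> {1..n}. s i \<le> k}"
      using j by auto
  next
    fix j assume "j \<in> s ` {i \<in> {1..n}. s i \<le> k}"
    then show "j \<in> {1..k}"
      using permutes_in_image[OF assms(1)] by auto
  qed
  moreover have "inj_on s {i \<in> {1..n}. s i \<le> k}"
    using permutes_inj[OF assms(1)] by (rule inj_on_subset) simp
  ultimately show ?thesis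
    by (metis card_image card_atLeastAtMost diff_Suc_1)
qed

lemma missed_le_harm:
  assumes "s permutes {1..n}" "k \<le> n" "\<And>i. i \<in> {1..n} \<Longrightarrow> 0 < f i"
  shows "missed f k {1..n} \<le> (1 + harm k) * sum f {i \<in> {1..n}. k < s i}"
proof -
  let ?A = "{i \<in> {1..n}. s i \<le> k}" and ?B = "{i \<in> {1..n}. k < s i}"
  have AB: "{1..n} = ?A \<union> ?B" by auto
  have "missed f k (?A \<union> ?B) \<le> missed f k ?A + sum f ?B * (1 + harm k)"
    using assms(3) by (intro missed_Un_le) auto
  \<comment> \<open>Exactly \<open>k\<close> items sit in the first \<open>k\<close> slots, so
    \<open>k\<close> draws exhaust them.\<close>
  also have "missed f k ?A = 0"
    by (intro missed_eq_0) (use card_permutes_le[OF assms(1,2)] in simp_all)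
  finally show ?thesis unfolding AB[symmetric] by (simp add: mult.commute)
qed

text \<open>The comparison holds increment by increment. A zero increment contributes nothing, and a
  positive one after slot \<open>k\<close> puts slots \<open>1\<close> to \<open>k\<close> below the
  maximum, whence \<open>k \<le> K\<close> and \<open>harm k \<le> harm K\<close>.\<close>

lemma expected_cost_fcfs_le_general:
  assumes inst: "osa_instance n f c" and K: "card {i \<in> {1..n}. c i < Max (c ` {1..n})} \<le> K"
    and s: "s permutes {1..n}"
  shows "expected_cost fcfs n f c \<le> (1 + harm K) * assignment_cost n f c s"
proof -
  have n: "1 \<le> n" and pos: "\<And>i. i \<in> {1..n} \<Longrightarrow> 0 < f i" and c1: "0 \<le> c 1"
    and mono: "mono_on {1..n} c"
    using inst by (auto simp: osa_instance_def)
  have "(c (Suc k) - c k) * missed f k {1..n}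
      \<le> (1 + harm K) * ((c (Suc k) - c k) * sum f {i \<in> {1..n}. k < s i})" if k: "k \<in> {1..<n}" for k
  proof (cases "c k < c (Suc k)")
    case True
    have "{1..k} \<subseteq> {i \<in> {1..n}. c i < Max (c ` {1..n})}"
    proof safe
      fix i assume i: "i \<in> {1..k}"
      have "c i \<le> c k" using i k by (intro mono_onD[OF mono]) auto
      also note True
      also have "c (Suc k) \<le> Max (c ` {1..n})" using k by (intro Max_ge) auto
      finally show "c i < Max (c ` {1..n})" .
    qed (use k in auto)
    from card_mono[OF _ this] K have "k \<le> K" by simp
    then have "missed f k {1..n} \<le> (1 + harm K) * sum f {i \<in> {1..n}. k < s i}"
      using k pos
      by (intro order_trans[OF missed_le_harm[OF s]] mult_right_mono add_left_mono harm_mono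
          sum_nonneg) (auto simp: less_imp_le)
    with True show ?thesis
      by (simp add: mult.left_commute mult_left_mono)
  next
    case False
    have "c k \<le> c (Suc k)" using k by (intro mono_onD[OF mono]) auto
    with False show ?thesis by simp
  qed
  then have "(\<Sum>k=1..<n. (c (Suc k) - c k) * missed f k {1..n})
      \<le> (1 + harm K) * (\<Sum>k=1..<n. (c (Suc k) - c k) * sum f {i \<in> {1..n}. k < s i})"
    unfolding sum_distrib_left by (rule sum_mono)
  moreover have "c 1 * (\<Sum>i=1..n. f i) \<le> (1 + harm K) * (c 1 * (\<Sum>i=1..n. f i))"
    using c1 sum_f_pos[OF inst] harm_nonneg[of K, where 'a=real]
    by (simp add: distrib_right)
  moreover have "s i \<in> {1..n}" if "i \<in> {1..n}" for i
    using permutes_in_image[OF s] that by blast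
  ultimately show ?thesis
    unfolding expected_cost_fcfs[OF inst] by (subst assignment_cost_increments) (auto simp: distrib_left)
qed

section \<open>The factor 2 for concave costs\<close>

text \<open>Split the items at rank \<open>m\<close>. A pair of early items contributes, from each
  side, at most the weight of the one ranked later, and at most \<open>s i - 1\<close> items rank
  before \<open>i\<close>. A late item contributes at most \<open>m\<close> times its weight through
  the minimum, and as much again through its pairs with the at most \<open>m\<close> early
  items.\<close>

lemma sum_harmonic_pairs_le:
  fixes f :: "'a \<Rightarrow> real" and s :: "'a \<Rightarrow> nat"
  assumes fin: "finite I" and pos: "\<And>i. i \<in> I \<Longrightarrow> 0 < f i"
    and inj: "inj_on s I" and ge: "\<And>i. i \<in> I \<Longrightarrow> 1 \<le> s i"
  shows "(\<Sum>i\<in>I. f i * min (real m) (\<Sum>l\<in>I - {i}. f l / (f l + f i)))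
    \<le> 2 * (\<Sum>i\<in>I. f i * min (real m) (real (s i) - 1))"
proof -
  define A where "A = {i \<in> I. s i \<le> m}"
  define B where "B = {i \<in> I. m < s i}"
  have I: "I = A \<union> B" and disj: "A \<inter> B = {}" and finA: "finite A" and finB: "finite B"
    using fin by (auto simp: A_def B_def)
  have card_less: "card {l \<in> A. s l < j} \<le> j - 1" if "1 \<le> j" for j
  proof -
    have "card {l \<in> A. s l < j} = card (s ` {l \<in> A. s l < j})"
      using inj by (intro card_image[symmetric] inj_on_subset[OF inj]) (auto simp: A_def)
    also have "\<dots> \<le> card {1..<j}"
      using ge by (intro card_mono) (auto simp: A_def)
    finally show ?thesis by simp
  qed
  have "card A \<le> m"
    using card_less[of "Suc m"] by (simp add: A_def less_Suc_eq_le)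
  \<comment> \<open>Half the harmonic mean of \<open>f i\<close> and \<open>f l\<close>, hence below
    both.\<close>
  define g where "g i l = f i * (f l / (f l + f i))" for i l
  have g_nonneg: "0 \<le> g i l" if "i \<in> I" "l \<in> I" for i l
    using pos[OF that(1)] pos[OF that(2)] by (simp add: g_def)
  have g_le: "g i l \<le> f i" "g i l \<le> f l" if "i \<in> I" "l \<in> I" for i l
    using pos[OF that(1)] pos[OF that(2)] by (simp_all add: g_def field_simps)
  \<comment> \<open>Charges a pair to the item that \<open>s\<close> ranks later.\<close>
  define h where "h i l = (if s l < s i then f i else 0)" for i l
  have g_le_h: "g i l \<le> h i l + h l i" if "i \<in> I" "l \<in> I" "i \<noteq> l" for i l
  proof -
    have "s i \<noteq> s l" using inj that by (meson inj_onD)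
    then show ?thesis
      using g_le[OF that(1,2)] by (auto simp: h_def)
  qed
  have inA: "f i * min (real m) (\<Sum>l\<in>I - {i}. f l / (f l + f i))
      \<le> (\<Sum>l\<in>A. h i l) + (\<Sum>l\<in>A. h l i) + (\<Sum>l\<in>B. f l)" if i: "i \<in> A" for i
  proof -
    have iI: "i \<in> I" using i I by blast
    have "f i * min (real m) (\<Sum>l\<in>I - {i}. f l / (f l + f i)) \<le> f i * (\<Sum>l\<in>I - {i}. f l / (f l + f i))"
      using pos[OF iI] by (intro mult_left_mono) auto
    also have "\<dots> = (\<Sum>l\<in>I - {i}. g i l)"
      by (simp add: g_def sum_distrib_left)
    also have "\<dots> = (\<Sum>l\<in>(A - {i}) \<union> B. g i l)"
      using I disj i by (intro sum.cong) auto
    also have "\<dots> = (\<Sum>l\<in>A - {i}. g i l) + (\<Sum>l\<in>B. g i l)"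
      using finA finB disj by (intro sum.union_disjoint) auto
    also have "\<dots> \<le> (\<Sum>l\<in>A - {i}. h i l + h l i) + (\<Sum>l\<in>B. f l)"
      using I iI by (intro add_mono sum_mono g_le_h g_le(2)) auto
    also have "(\<Sum>l\<in>A - {i}. h i l + h l i) = (\<Sum>l\<in>A. h i l + h l i)"
      using finA i by (simp add: sum.remove[of A i] h_def)
    finally show ?thesis by (simp add: sum.distrib)
  qed
  have "(\<Sum>i\<in>I. f i * min (real m) (\<Sum>l\<in>I - {i}. f l / (f l + f i)))
      = (\<Sum>i\<in>A. f i * min (real m) (\<Sum>l\<in>I - {i}. f l / (f l + f i)))
        + (\<Sum>i\<in>B. f i * min (real m) (\<Sum>l\<in>I - {i}. f l / (f l + f i)))"
    using finA finB disj by (subst (1) I) (rule sum.union_disjoint)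
  also have "\<dots> \<le> (\<Sum>i\<in>A. (\<Sum>l\<in>A. h i l) + (\<Sum>l\<in>A. h l i) + (\<Sum>l\<in>B. f l)) + (\<Sum>i\<in>B. f i * real m)"
    using I pos by (intro add_mono sum_mono inA mult_left_mono) (auto simp: less_imp_le)
  \<comment> \<open>The two \<open>h\<close>-sums agree after exchanging the indices, which gives
    the factor \<open>2\<close>.\<close>
  also have "\<dots> = 2 * (\<Sum>i\<in>A. \<Sum>l\<in>A. h i l) + real (card A) * sum f B + real m * sum f B"
    using sum.swap[of h A A] by (simp add: sum.distrib mult.commute flip: sum_distrib_left)
  also have "\<dots> \<le> 2 * (\<Sum>i\<in>A. f i * (real (s i) - 1)) + real m * sum f B + real m * sum f B"
  proof (intro add_mono mult_left_mono sum_mono order_refl mult_right_mono)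
    fix i assume i: "i \<in> A"
    then have iI: "i \<in> I" using I by blast
    have "(\<Sum>l\<in>A. h i l) = f i * real (card {l \<in> A. s l < s i})"
      unfolding h_def using finA by (subst sum.inter_filter[symmetric]) auto
    also have "\<dots> \<le> f i * (real (s i) - 1)"
      using pos[OF iI] card_less[OF ge[OF iI]] ge[OF iI] by (intro mult_left_mono) auto
    finally show "(\<Sum>l\<in>A. h i l) \<le> f i * (real (s i) - 1)" .
  next
    show "0 \<le> sum f B" using pos I by (intro sum_nonneg) (auto simp: less_imp_le)
  qed (use \<open>card A \<le> m\<close> in auto)
  also have "\<dots> = 2 * ((\<Sum>i\<in>A. f i * min (real m) (real (s i) - 1)) + (\<Sum>i\<in>B. f i * min (real m) (real (s i) - 1)))"
  proof -
    have "(\<Sum>i\<in>A. f i * min (real m) (real (s i) - 1)) = (\<Sum>i\<in>A. f i * (real (s i) - 1))"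
      by (intro sum.cong) (auto simp: A_def)
    moreover have "(\<Sum>i\<in>B. f i * min (real m) (real (s i) - 1)) = (\<Sum>i\<in>B. f i * real m)"
      by (intro sum.cong) (auto simp: B_def)
    ultimately show ?thesis by (simp add: mult.commute flip: sum_distrib_left)
  qed
  also have "(\<Sum>i\<in>A. f i * min (real m) (real (s i) - 1)) + (\<Sum>i\<in>B. f i * min (real m) (real (s i) - 1))
      = (\<Sum>i\<in>I. f i * min (real m) (real (s i) - 1))"
    using finA finB disj by (subst I) (rule sum.union_disjoint[symmetric])
  finally show ?thesis .
qed

lemma expectation_num_before_request:
  assumes "osa_instance n f c" "i \<in> {1..n}"
  shows "(\<integral>\<omega>. real (num_before {1..n} \<omega> i) \<partial>request_space n f)
    = (\<Sum>l\<in>{1..n} - {i}. f l / (f l + f i))"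
proof -
  interpret request_stream "request_pmf n f"
    using assms(1) by (rule request_stream_request_pmf)
  have "pmf (request_pmf n f) l / (pmf (request_pmf n f) l + pmf (request_pmf n f) i)
      = f l / (f l + f i)" if "l \<in> {1..n}" for l
    using sum_f_pos[OF assms(1)] that assms(2)
    by (simp add: pmf_request_pmf[OF assms(1)] flip: add_divide_distrib)
  then show ?thesis
    unfolding request_space_def
    using expectation_num_before[of "{1..n}" i] assms(2) by (simp add: set_request_pmf[OF assms(1)])
qed

text \<open>Summed over \<open>k\<close>, the probabilities that \<open>i\<close> has at least
  \<open>k\<close> predecessors are at most \<open>m\<close> and at most the mean number of
  predecessors. On the side of the permutation, \<open>i\<close> is counted
  \<open>min m (s i - 1)\<close> times.\<close>

lemma sum_missed_le:
  assumes inst: "osa_instance n f c" and s: "s permutes {1..n}"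
  shows "(\<Sum>k=1..m. missed f k {1..n}) \<le> 2 * (\<Sum>k=1..m. sum f {i \<in> {1..n}. k < s i})"
proof -
  interpret request_stream "request_pmf n f"
    using inst by (rule request_stream_request_pmf)
  have pos: "\<And>i. i \<in> {1..n} \<Longrightarrow> 0 < f i"
    using inst by (auto simp: osa_instance_def)
  have s_ge: "1 \<le> s i" if "i \<in> {1..n}" for i
    using permutes_in_image[OF s, of i] that by simp
  have "(\<Sum>k=1..m. missed f k {1..n})
      = (\<Sum>i=1..n. f i * (\<Sum>k=1..m. S.prob {\<omega>. k \<le> num_before {1..n} \<omega> i}))"
    unfolding missed_eq_sum_prob[OF inst] request_space_def sum_distrib_left by (rule sum.swap)
  also have "\<dots> \<le> (\<Sum>i=1..n. f i * min (real m) (\<Sum>l\<in>{1..n} - {i}. f l / (f l + f i)))"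
  proof (intro sum_mono mult_left_mono min.boundedI)
    fix i assume i: "i \<in> {1..n}"
    show "0 \<le> f i" using pos[OF i] by simp
    have "(\<Sum>k=1..m. S.prob {\<omega>. k \<le> num_before {1..n} \<omega> i}) \<le> (\<Sum>k=1..m. 1)"
      by (intro sum_mono) simp
    then show "(\<Sum>k=1..m. S.prob {\<omega>. k \<le> num_before {1..n} \<omega> i}) \<le> real m" by simp
    show "(\<Sum>k=1..m. S.prob {\<omega>. k \<le> num_before {1..n} \<omega> i})
        \<le> (\<Sum>l\<in>{1..n} - {i}. f l / (f l + f i))"
      using sum_prob_num_before_ge_le[of "{1..n}" i m] expectation_num_before_request[OF inst i]
      by (simp add: request_space_def)
  qed
  also have "\<dots> \<le> 2 * (\<Sum>i=1..n. f i * min (real m) (real (s i) - 1))"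
    using pos s_ge permutes_inj[OF s] by (intro sum_harmonic_pairs_le) (auto intro: inj_on_subset)
  also have "(\<Sum>i=1..n. f i * min (real m) (real (s i) - 1))
      = (\<Sum>i=1..n. \<Sum>k=1..m. if k < s i then f i else 0)"
  proof (intro sum.cong refl)
    fix i assume i: "i \<in> {1..n}"
    have "(\<Sum>k=1..m. if k < s i then f i else 0) = f i * real (card {k \<in> {1..m}. k < s i})"
      by (subst sum.inter_filter[symmetric]) auto
    also have "{k \<in> {1..m}. k < s i} = {1..min m (s i - 1)}" by auto
    also have "real (card {1..min m (s i - 1)}) = min (real m) (real (s i) - 1)"
      using s_ge[OF i] by (auto simp: min_def)
    finally show "f i * min (real m) (real (s i) - 1) = (\<Sum>k=1..m. if k < s i then f i else 0)" ..
  qed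
  also have "\<dots> = (\<Sum>k=1..m. sum f {i \<in> {1..n}. k < s i})"
    by (subst sum.swap) (simp only: sum.inter_filter finite_atLeastAtMost)
  finally show ?thesis .
qed

text \<open>A partial sum is nonnegative, so replacing its factor \<open>d m\<close> by the smaller
  \<open>d (Suc m)\<close> only lowers the product. Comparing with the last weight times the full
  sum, rather than with \<open>0\<close>, is what lets the induction pass.\<close>

lemma abel_sum_ge:
  fixes a d :: "nat \<Rightarrow> real"
  assumes "\<And>k. 1 \<le> k \<Longrightarrow> k < m \<Longrightarrow> d (Suc k) \<le> d k" "\<And>j. j \<le> m \<Longrightarrow> 0 \<le> (\<Sum>k=1..j. a k)" "1 \<le> m"
  shows "d m * (\<Sum>k=1..m. a k) \<le> (\<Sum>k=1..m. d k * a k)"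
  using assms(3,1,2)
proof (induction m rule: dec_induct)
  case base
  show ?case by simp
next
  case (step m)
  have "d (Suc m) * (\<Sum>k=1..Suc m. a k) = d (Suc m) * (\<Sum>k=1..m. a k) + d (Suc m) * a (Suc m)"
    by (simp add: distrib_left)
  also have "d (Suc m) * (\<Sum>k=1..m. a k) \<le> d m * (\<Sum>k=1..m. a k)"
    using step by (intro mult_right_mono) auto
  also have "\<dots> \<le> (\<Sum>k=1..m. d k * a k)"
    using step by auto
  finally show ?case by simp
qed

lemma expected_cost_fcfs_le_concave:
  assumes inst: "osa_instance n f c" and conc: "concave_costs n c" and s: "s permutes {1..n}"
  shows "expected_cost fcfs n f c \<le> 2 * assignment_cost n f c s"
proof -
  have n: "1 \<le> n" and c1: "0 \<le> c 1" and mono: "mono_on {1..n} c"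
    using inst by (auto simp: osa_instance_def)
  define d where "d k = c (Suc k) - c k" for k
  \<comment> \<open>The slack at threshold \<open>k\<close>. Only its partial sums are known to be
    nonnegative, hence the Abel summation against the decreasing increments
    \<open>d\<close>.\<close>
  define a where "a k = 2 * sum f {i \<in> {1..n}. k < s i} - missed f k {1..n}" for k
  have a_sum: "0 \<le> (\<Sum>k=1..j. a k)" for j
    using sum_missed_le[OF inst s, of j] by (simp add: a_def sum_subtractf sum_distrib_left)
  have "0 \<le> (\<Sum>k=1..<n. d k * a k)"
  proof (cases "n = 1")
    case False
    then obtain m where m: "n = Suc m" "1 \<le> m" using n by (cases n) auto
    have "d (Suc k) \<le> d k" if "1 \<le> k" "k < m" for k
      using conc that m by (auto simp: concave_costs_def d_def)
    then have "d m * (\<Sum>k=1..m. a k) \<le> (\<Sum>k=1..m. d k * a k)"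
      using a_sum m by (intro abel_sum_ge)
    moreover have "0 \<le> d m"
      using m mono_onD[OF mono, of m "Suc m"] by (simp add: d_def)
    ultimately show ?thesis
      using a_sum[of m] m by (simp add: atLeastLessThanSuc_atLeastAtMost)
        (meson mult_nonneg_nonneg order_trans)
  qed simp
  then have "(\<Sum>k=1..<n. d k * missed f k {1..n}) \<le> 2 * (\<Sum>k=1..<n. d k * sum f {i \<in> {1..n}. k < s i})"
    by (simp add: a_def right_diff_distrib sum_subtractf sum_distrib_left mult_ac)
  moreover have "c 1 * (\<Sum>i=1..n. f i) \<le> 2 * (c 1 * (\<Sum>i=1..n. f i))"
    using c1 sum_f_pos[OF inst] by simp
  moreover have "s i \<in> {1..n}" if "i \<in> {1..n}" for i
    using permutes_in_image[OF s] that by blast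
  ultimately show ?thesis
    unfolding expected_cost_fcfs[OF inst]
    by (subst assignment_cost_increments) (auto simp: d_def distrib_left)
qed

section \<open>From cost bounds to competitive ratios\<close>

lemma opt_attained:
  obtains s where "s permutes {1..n}" "opt n f c = assignment_cost n f c s"
proof -
  have "finite {s. s permutes {1..n}}" by (simp add: finite_permutations)
  moreover have "{s. s permutes {1..n}} \<noteq> {}" using permutes_id by blast
  ultimately have "opt n f c \<in> assignment_cost n f c ` {s. s permutes {1..n}}"
    unfolding opt_def by (intro Min_in) auto
  then show ?thesis using that by auto
qed

lemma assignment_cost_nonneg:
  assumes "osa_instance n f c" "s permutes {1..n}"
  shows "0 \<le> assignment_cost n f c s"
  unfolding assignment_cost_def
proof (intro sum_nonneg mult_nonneg_nonneg)
  fix i assume i: "i \<in> {1..n}"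
  then have "s i \<in> {1..n}" using permutes_in_image[OF assms(2)] by blast
  with i show "0 \<le> f i" "0 \<le> c (s i)"
    using assms(1) by (auto simp: osa_instance_def less_imp_le)
qed

lemma expected_cost_fcfs_nonneg:
  assumes "osa_instance n f c"
  shows "0 \<le> expected_cost fcfs n f c"
proof -
  have pos: "\<And>i. i \<in> {1..n} \<Longrightarrow> 0 < f i" and c1: "0 \<le> c 1" and mono: "mono_on {1..n} c"
    using assms by (auto simp: osa_instance_def)
  have "0 \<le> c (Suc k) - c k" if "k \<in> {1..<n}" for k
    using that mono_onD[OF mono, of k "Suc k"] by auto
  then show ?thesis
    unfolding expected_cost_fcfs[OF assms] using c1 sum_f_pos[OF assms] pos
    by (intro add_nonneg_nonneg sum_nonneg mult_nonneg_nonneg missed_nonneg) (auto simp: less_imp_le)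
qed

lemma competitive_ratio_fcfs_le:
  assumes "\<And>n f c. (n, f, c) \<in> I \<Longrightarrow> osa_instance n f c"
    and "\<And>n f c s. (n, f, c) \<in> I \<Longrightarrow> s permutes {1..n} \<Longrightarrow>
      expected_cost fcfs n f c \<le> r * assignment_cost n f c s"
    and "0 \<le> r"
  shows "competitive_ratio fcfs I \<le> ereal r"
  unfolding competitive_ratio_def
proof (rule SUP_least, clarify)
  fix n f c assume I: "(n, f, c) \<in> I"
  obtain s where s: "s permutes {1..n}" "opt n f c = assignment_cost n f c s"
    by (rule opt_attained)
  have le: "expected_cost fcfs n f c \<le> r * opt n f c"
    using assms(2)[OF I s(1)] s(2) by simp
  have opt0: "0 \<le> opt n f c"
    using assignment_cost_nonneg[OF assms(1)[OF I] s(1)] s(2) by simp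
  show "ereal (expected_cost fcfs n f c) / ereal (opt n f c) \<le> ereal r"
  proof (cases "opt n f c = 0")
    case True
    \<comment> \<open>An optimum of \<open>0\<close> forces the cost to be \<open>0\<close>, and
      \<open>0 / 0 = 0\<close> in \<open>ereal\<close>.\<close>
    with le expected_cost_fcfs_nonneg[OF assms(1)[OF I]] have "expected_cost fcfs n f c = 0" by simp
    with assms(3) show ?thesis by simp
  next
    case False
    with opt0 le show ?thesis by (simp add: field_simps)
  qed
qed

section \<open>Logarithmic costs and entropy\<close>

text \<open>Turns the asymptotic hypothesis into a bound with explicit constants for every slot. The
  function \<open>ln (1 + log 2 j)\<close> is defined and nonnegative from \<open>j = 1\<close> on
  and dominates \<open>ln (ln j)\<close> for large \<open>j\<close>.\<close>

lemma log_cost_deviation: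
  fixes c :: "nat \<Rightarrow> real"
  assumes "(\<lambda>j. c j - log 2 (real j)) \<in> O(\<lambda>j. ln (ln (real j)))"
  obtains C D where "0 \<le> C" "0 \<le> D"
    "\<And>j. 1 \<le> j \<Longrightarrow> \<bar>c j - log 2 (real j)\<bar> \<le> C * ln (1 + log 2 (real j)) + D"
proof -
  obtain C where C: "0 < C"
    and ev: "eventually (\<lambda>j. norm (c j - log 2 (real j)) \<le> C * norm (ln (ln (real j)))) at_top"
    using assms by (elim landau_o.bigE)
  then obtain N where N: "\<And>j. N \<le> j \<Longrightarrow> \<bar>c j - log 2 (real j)\<bar> \<le> C * \<bar>ln (ln (real j))\<bar>"
    by (auto simp: eventually_at_top_linorder)
  \<comment> \<open>Absorbs the finitely many small slots. The threshold
    \<open>3 \<ge> exp 1\<close> ensures \<open>ln j \<ge> 1\<close>, so that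
    \<open>ln (ln j)\<close> is nonnegative beyond it.\<close>
  define D where "D = (\<Sum>j<max N 3. \<bar>c j - log 2 (real j)\<bar>)"
  have D: "0 \<le> D" unfolding D_def by (intro sum_nonneg) auto
  show ?thesis
  proof (rule that[of C D])
    fix j :: nat assume j: "1 \<le> j"
    have log0: "0 \<le> log 2 (real j)" using j by simp
    show "\<bar>c j - log 2 (real j)\<bar> \<le> C * ln (1 + log 2 (real j)) + D"
    proof (cases "j < max N 3")
      case True
      then have "\<bar>c j - log 2 (real j)\<bar> \<le> D"
        unfolding D_def by (intro member_le_sum) auto
      moreover have "0 \<le> C * ln (1 + log 2 (real j))"
        using C log0 by simp
      ultimately show ?thesis by linarith
    next
      case False
      then have j3: "3 \<le> real j" and "N \<le> j" by auto
      have "exp 1 \<le> real j" using exp_le j3 by linarith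
      then have ln1: "1 \<le> ln (real j)" using j by (simp add: ln_ge_iff)
      have "ln 2 \<le> (1::real)" using ln_2_less_1 by simp
      then have "ln (real j) \<le> log 2 (real j)"
        using ln1 by (simp add: log_def field_simps mult_left_le)
      then have "ln (ln (real j)) \<le> ln (1 + log 2 (real j))"
        using ln1 by (intro ln_mono) auto
      moreover have "0 \<le> ln (ln (real j))" using ln1 by simp
      ultimately have "C * \<bar>ln (ln (real j))\<bar> \<le> C * ln (1 + log 2 (real j))"
        using C by (intro mult_left_mono) auto
      with N[OF \<open>N \<le> j\<close>] D show ?thesis by linarith
    qed
  qed (use C D in auto)
qed

lemma ln_one_plus_tangent:
  fixes x y :: real
  assumes "0 \<le> x" "0 \<le> y"
  shows "ln (1 + x) \<le> ln (1 + y) + (x - y) / (1 + y)"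
proof -
  have "ln ((1 + x) / (1 + y)) \<le> (1 + x) / (1 + y) - 1"
    using assms by (intro ln_le_minus_one) auto
  also have "\<dots> = (x - y) / (1 + y)"
    using assms by (simp add: field_simps)
  finally show ?thesis
    using assms by (simp add: ln_div)
qed

text \<open>With \<open>y\<close> equal to the mean of \<open>x\<close> this is Jensen's inequality.
  The point \<open>y\<close> stays free because the FCFS bound takes it fixed at the entropy, while
  the mean varies with the stream.\<close>

lemma weighted_ln_tangent:
  fixes f x :: "'a \<Rightarrow> real"
  assumes "\<And>i. i \<in> I \<Longrightarrow> 0 \<le> f i" "sum f I = 1" "\<And>i. i \<in> I \<Longrightarrow> 0 \<le> x i" "0 \<le> y"
  shows "(\<Sum>i\<in>I. f i * ln (1 + x i)) \<le> ln (1 + y) + ((\<Sum>i\<in>I. f i * x i) - y) / (1 + y)"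
proof -
  have "(\<Sum>i\<in>I. f i * ln (1 + x i)) \<le> (\<Sum>i\<in>I. f i * (ln (1 + y) + (x i - y) / (1 + y)))"
    using assms by (intro sum_mono mult_left_mono ln_one_plus_tangent) auto
  also have "\<dots> = (\<Sum>i\<in>I. f i * ln (1 + y) + (f i * x i - f i * y) / (1 + y))"
    by (simp add: algebra_simps)
  also have "\<dots> = sum f I * ln (1 + y) + ((\<Sum>i\<in>I. f i * x i) - sum f I * y) / (1 + y)"
    by (simp add: sum.distrib sum_subtractf flip: sum_distrib_right sum_divide_distrib)
  finally show ?thesis by (simp add: assms(2))
qed

lemma weighted_log_cost_le:
  fixes f x :: "'a \<Rightarrow> real"
  assumes "\<And>i. i \<in> I \<Longrightarrow> 0 \<le> f i" "sum f I = 1" "\<And>i. i \<in> I \<Longrightarrow> 0 \<le> x i" "0 \<le> y" "0 \<le> C"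
  shows "(\<Sum>i\<in>I. f i * (C * ln (1 + x i) + D))
    \<le> C * (ln (1 + y) + ((\<Sum>i\<in>I. f i * x i) - y) / (1 + y)) + D"
proof -
  have "(\<Sum>i\<in>I. f i * (C * ln (1 + x i) + D)) = C * (\<Sum>i\<in>I. f i * ln (1 + x i)) + sum f I * D"
    by (simp add: distrib_left sum.distrib sum_distrib_left sum_distrib_right mult_ac)
  also have "\<dots> \<le> C * (ln (1 + y) + ((\<Sum>i\<in>I. f i * x i) - y) / (1 + y)) + D"
    using mult_left_mono[OF weighted_ln_tangent[OF assms(1-4)] assms(5)] assms(2) by simp
  finally show ?thesis .
qed

section \<open>The cost of FCFS against the entropy\<close>

lemma frequency_entropy_nonneg:
  assumes "osa_instance n f c" "(\<Sum>i=1..n. f i) = 1"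
  shows "0 \<le> frequency_entropy n f"
  unfolding frequency_entropy_def
proof (intro sum_nonneg)
  fix i assume i: "i \<in> {1..n}"
  have pos: "\<And>i. i \<in> {1..n} \<Longrightarrow> 0 < f i" using assms(1) by (auto simp: osa_instance_def)
  have "f i \<le> 1"
    using member_le_sum[OF i, of f] pos assms(2) by (simp add: less_imp_le)
  with pos[OF i] show "0 \<le> f i * log 2 (1 / f i)" by simp
qed

text \<open>Each item has mean slot at most \<open>1 / f i\<close>, from
  \<open>f l / (f l + f i) \<le> f l / f i\<close>. The weights are squared because the tangent to
  \<open>ln\<close> at \<open>1 / f i\<close> has slope \<open>f i\<close>, on top of the weight
  \<open>f i\<close> in the cost.\<close>

lemma expected_weighted_slot_le:
  assumes inst: "osa_instance n f c" and norm: "(\<Sum>i=1..n. f i) = 1"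
  shows "(\<integral>\<omega>. (\<Sum>i=1..n. (f i)\<^sup>2 * (1 + real (num_before {1..n} \<omega> i))) \<partial>request_space n f) \<le> 1"
proof -
  interpret request_stream "request_pmf n f"
    using inst by (rule request_stream_request_pmf)
  have pos: "\<And>i. i \<in> {1..n} \<Longrightarrow> 0 < f i" using inst by (auto simp: osa_instance_def)
  have "(\<integral>\<omega>. (\<Sum>i=1..n. (f i)\<^sup>2 * (1 + real (num_before {1..n} \<omega> i))) \<partial>request_space n f)
      = (\<Sum>i=1..n. (f i)\<^sup>2 * (1 + (\<integral>\<omega>. real (num_before {1..n} \<omega> i) \<partial>request_space n f)))"
    unfolding request_space_def using S.prob_space
    by (subst Bochner_Integration.integral_sum) (auto simp: integrable_num_before)
  also have "\<dots> \<le> (\<Sum>i=1..n. f i)"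
  proof (intro sum_mono)
    fix i assume i: "i \<in> {1..n}"
    have "(\<Sum>l\<in>{1..n} - {i}. f l / (f l + f i)) \<le> (\<Sum>l\<in>{1..n} - {i}. f l / f i)"
      using pos[OF i] pos by (intro sum_mono divide_left_mono) (auto simp: less_imp_le add_pos_pos)
    also have "\<dots> = (1 - f i) / f i"
      using i norm by (simp add: sum_diff1 flip: sum_divide_distrib)
    finally have "(f i)\<^sup>2 * (1 + (\<Sum>l\<in>{1..n} - {i}. f l / (f l + f i))) \<le> (f i)\<^sup>2 * (1 + (1 - f i) / f i)"
      by (intro mult_left_mono add_left_mono) auto
    also have "\<dots> = f i" using pos[OF i] by (simp add: field_simps power2_eq_square)
    finally show "(f i)\<^sup>2 * (1 + (\<integral>\<omega>. real (num_before {1..n} \<omega> i) \<partial>request_space n f)) \<le> f i"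
      by (simp only: expectation_num_before_request[OF inst i])
  qed
  finally show ?thesis using norm by simp
qed

text \<open>On almost every stream the cost is below an affine function of \<open>W\<close> that has
  nonnegative slope and the claimed value at \<open>W = 1\<close>; the mean of \<open>W\<close> is
  at most \<open>1\<close>.\<close>

lemma expected_cost_fcfs_le_entropy:
  assumes inst: "osa_instance n f c" and norm: "(\<Sum>i=1..n. f i) = 1" and C: "0 \<le> C"
    and dev: "\<And>j. 1 \<le> j \<Longrightarrow> c j \<le> log 2 (real j) + (C * ln (1 + log 2 (real j)) + D)"
  shows "expected_cost fcfs n f c
    \<le> frequency_entropy n f + (C * ln (1 + frequency_entropy n f) + D)"
proof -
  interpret request_stream "request_pmf n f"
    using inst by (rule request_stream_request_pmf)
  have pos: "\<And>i. i \<in> {1..n} \<Longrightarrow> 0 < f i" using inst by (auto simp: osa_instance_def)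
  let ?H = "frequency_entropy n f"
  have H: "0 \<le> ?H" by (rule frequency_entropy_nonneg[OF inst norm])
  define W where "W \<omega> = (\<Sum>i=1..n. (f i)\<^sup>2 * (1 + real (num_before {1..n} \<omega> i)))" for \<omega>
  \<comment> \<open>Slope of the affine bound: \<open>1\<close> from the mean logarithm,
    \<open>C / (1 + ?H)\<close> from the tangent to \<open>C * ln (1 + x)\<close> at the entropy,
    and \<open>ln 2\<close> from the change of base.\<close>
  define a where "a = (1 + C / (1 + ?H)) / ln 2"
  have a: "0 \<le> a" using C H by (simp add: a_def)
  let ?b = "?H + (C * ln (1 + ?H) + D)"
  have W_int: "integrable (request_space n f) W"
    unfolding W_def request_space_def
    by (intro Bochner_Integration.integrable_sum integrable_mult_right
        Bochner_Integration.integrable_add integrable_num_before) auto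
  have "AE \<omega> in request_space n f.
      assignment_cost n f c (slot_of fcfs n c \<omega>) \<le> ?b + a * (W \<omega> - 1)"
    using AE_slot_of_fcfs[OF inst]
  proof eventually_elim
    case (elim \<omega>)
    define j where "j i = Suc (num_before {1..n} \<omega> i)" for i
    define L where "L = (\<Sum>i=1..n. f i * log 2 (real (j i)))"
    have "L \<le> (\<Sum>i=1..n. f i * log 2 (1 / f i) + ((f i)\<^sup>2 * real (j i) - f i) / ln 2)"
      unfolding L_def
    proof (intro sum_mono)
      fix i assume i: "i \<in> {1..n}"
      \<comment> \<open>The tangent line of \<open>ln\<close> at \<open>1 / f i\<close>, evaluated
        at the slot \<open>j i\<close>.\<close>
      have "ln (f i * real (j i)) \<le> f i * real (j i) - 1"
        using pos[OF i] by (intro ln_le_minus_one) (auto simp: j_def)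
      then have "ln (real (j i)) \<le> ln (1 / f i) + (f i * real (j i) - 1)"
        using pos[OF i] by (simp add: ln_mult ln_div j_def)
      then have "log 2 (real (j i)) \<le> log 2 (1 / f i) + (f i * real (j i) - 1) / ln 2"
        unfolding log_def add_divide_distrib[symmetric] by (intro divide_right_mono) auto
      then have "f i * log 2 (real (j i)) \<le> f i * (log 2 (1 / f i) + (f i * real (j i) - 1) / ln 2)"
        using pos[OF i] by (intro mult_left_mono) auto
      then show "f i * log 2 (real (j i)) \<le> f i * log 2 (1 / f i) + ((f i)\<^sup>2 * real (j i) - f i) / ln 2"
        by (simp add: distrib_left right_diff_distrib power2_eq_square mult_ac)
    qed
    also have "\<dots> = ?H + (W \<omega> - 1) / ln 2"
      unfolding frequency_entropy_def W_def j_def sum.distrib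
      using norm by (simp add: sum_subtractf flip: sum_divide_distrib)
    finally have L: "L - ?H \<le> (W \<omega> - 1) / ln 2" by simp
    have "assignment_cost n f c (slot_of fcfs n c \<omega>) = (\<Sum>i=1..n. f i * c (j i))"
      unfolding assignment_cost_def j_def using elim by (intro sum.cong) auto
    also have "\<dots> \<le> (\<Sum>i=1..n. f i * (log 2 (real (j i)) + (C * ln (1 + log 2 (real (j i))) + D)))"
      using pos by (intro sum_mono mult_left_mono dev) (auto simp: j_def less_imp_le)
    also have "\<dots> = L + (\<Sum>i=1..n. f i * (C * ln (1 + log 2 (real (j i))) + D))"
      unfolding L_def sum.distrib[symmetric] distrib_left[symmetric] ..
    also have "\<dots> \<le> L + (C * (ln (1 + ?H) + (L - ?H) / (1 + ?H)) + D)"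
      unfolding L_def using pos norm H C
      by (intro add_left_mono weighted_log_cost_le) (auto simp: j_def less_imp_le)
    also have "\<dots> = ?b + (1 + C / (1 + ?H)) * (L - ?H)"
      by (simp add: algebra_simps)
    also have "\<dots> \<le> ?b + (1 + C / (1 + ?H)) * ((W \<omega> - 1) / ln 2)"
      using L C H by (intro add_left_mono mult_left_mono) auto
    finally show ?case by (simp add: a_def)
  qed
  then have "expected_cost fcfs n f c \<le> (\<integral>\<omega>. ?b + a * (W \<omega> - 1) \<partial>request_space n f)"
    unfolding expected_cost_def using integrable_fcfs[OF inst] W_int
    by (intro integral_mono_AE) (auto simp: request_space_def)
  also have "\<dots> = ?b + a * ((\<integral>\<omega>. W \<omega> \<partial>request_space n f) - 1)"
    using W_int S.prob_space by (simp add: request_space_def)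
  also have "\<dots> \<le> ?b"
    using expected_weighted_slot_le[OF inst norm] a
    by (simp add: W_def[abs_def] mult_nonneg_nonpos)
  finally show ?thesis .
qed

section \<open>The entropy against the optimum\<close>

text \<open>Integral comparison: the fraction on the right is the integral of
  \<open>x powr - (1 + e)\<close> from \<open>1\<close> to \<open>n\<close>.\<close>

lemma sum_powr_le:
  fixes e :: real
  assumes "0 < e" "1 \<le> n"
  shows "(\<Sum>j=1..n. real j powr - (1 + e)) \<le> 1 + (1 - real n powr - e) / e"
  using assms(2)
proof (induction n rule: dec_induct)
  case base
  show ?case by simp
next
  case (step n)
  define x where "x = real (Suc n)"
  have n: "0 < real n" and x: "0 < x" "real n = x - 1" using step by (auto simp: x_def)
  \<comment> \<open>The chain yields \<open>1 + e / x \<le> (real n / x) powr - e\<close> from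
    \<open>ln y \<le> y - 1\<close> and \<open>1 + t \<le> exp t\<close>; this is the bound on one
    summand by its piece of the integral.\<close>
  have "1 + e / x = 1 + e * (1 - real n / x)"
    unfolding x(2) using x(1) by (simp add: field_simps)
  also have "\<dots> \<le> 1 + e * (- ln (real n / x))"
    using n x(1) assms ln_le_minus_one[of "real n / x"] by (intro add_left_mono mult_left_mono) auto
  also have "\<dots> \<le> exp (e * (- ln (real n / x)))"
    by (rule exp_ge_add_one_self)
  also have "\<dots> = (real n / x) powr - e"
    using n x(1) by (simp add: powr_def)
  also have "\<dots> = real n powr - e / x powr - e"
    using n x(1) by (simp add: powr_divide)
  finally have "x powr - e * (1 + e / x) \<le> real n powr - e"
    using x(1) by (simp add: pos_le_divide_eq mult.commute)
  moreover have "x powr - (1 + e) = x powr - e / x"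
  proof -
    have "- (1 + e) = - e - 1" by simp
    then show ?thesis using x(1) by (simp only: powr_diff powr_one)
  qed
  ultimately have "x powr - (1 + e) * e \<le> real n powr - e - x powr - e"
    by (simp add: distrib_left)
  then have "x powr - (1 + e) \<le> (real n powr - e - x powr - e) / e"
    using assms by (simp add: pos_le_divide_eq)
  with step.IH show ?case
    by (simp add: x_def diff_divide_distrib)
qed

text \<open>Gibbs' inequality against the weights \<open>q i / (2 + L)\<close>, whose total is at
  most \<open>1\<close>; the logarithms of the \<open>q i\<close> average to
  \<open>- (1 + e) * L * ln 2\<close>.\<close>

lemma entropy_le_mean_log:
  assumes inst: "osa_instance n f c" and norm: "(\<Sum>i=1..n. f i) = 1" and s: "s permutes {1..n}"
  defines "L \<equiv> \<Sum>i=1..n. f i * log 2 (real (s i))"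
  shows "0 \<le> L" "frequency_entropy n f \<le> L + 1 + log 2 (2 + L)"
proof -
  have pos: "\<And>i. i \<in> {1..n} \<Longrightarrow> 0 < f i" and n: "1 \<le> n" using inst by (auto simp: osa_instance_def)
  have s_ge: "1 \<le> s i" if "i \<in> {1..n}" for i
    using permutes_in_image[OF s, of i] that by simp
  have s_log: "0 \<le> log 2 (real (s i))" if "i \<in> {1..n}" for i
    using s_ge[OF that] by simp
  show L: "0 \<le> L"
    unfolding L_def using pos s_log by (intro sum_nonneg mult_nonneg_nonneg) (auto simp: less_imp_le)
  \<comment> \<open>Balances two losses: the normaliser \<open>1 + 1 / e\<close> becomes
    \<open>2 + L\<close>, while the extra term \<open>e * L\<close> stays at most
    \<open>1\<close>.\<close>
  define e where "e = 1 / (1 + L)"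
  have e: "0 < e" using L by (simp add: e_def)
  define q where "q i = real (s i) powr - (1 + e)" for i
  have "(\<Sum>i=1..n. q i) = (\<Sum>j=1..n. real j powr - (1 + e))"
    unfolding q_def using sum.permute[OF s, of "\<lambda>j. real j powr - (1 + e)"] by (simp add: o_def)
  also have "\<dots> \<le> 1 + (1 - real n powr - e) / e"
    using e n by (rule sum_powr_le)
  also have "\<dots> \<le> 1 + 1 / e"
    using e by (intro add_left_mono divide_right_mono) auto
  also have "\<dots> = 2 + L" using L by (simp add: e_def)
  finally have q_sum: "(\<Sum>i=1..n. q i) \<le> 2 + L" .
  have "(\<Sum>i=1..n. f i * (ln (1 / f i) - (1 + e) * ln (real (s i)) - ln (2 + L)))
      \<le> (\<Sum>i=1..n. q i / (2 + L) - f i)"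
  proof (intro sum_mono)
    fix i assume i: "i \<in> {1..n}"
    have "0 < q i" and lnq: "ln (q i) = - ((1 + e) * ln (real (s i)))"
      using s_ge[OF i] by (simp_all add: q_def ln_powr left_diff_distrib distrib_right)
    then have "ln (1 / f i) - (1 + e) * ln (real (s i)) - ln (2 + L) = ln (q i / ((2 + L) * f i))"
      using pos[OF i] L by (simp add: ln_div ln_mult)
    also have "\<dots> \<le> q i / ((2 + L) * f i) - 1"
      using pos[OF i] s_ge[OF i] L by (intro ln_le_minus_one) (auto simp: q_def)
    finally have "f i * (ln (1 / f i) - (1 + e) * ln (real (s i)) - ln (2 + L))
        \<le> f i * (q i / ((2 + L) * f i) - 1)"
      using pos[OF i] by (intro mult_left_mono) auto
    then show "f i * (ln (1 / f i) - (1 + e) * ln (real (s i)) - ln (2 + L)) \<le> q i / (2 + L) - f i"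
      using pos[OF i] by (simp add: right_diff_distrib)
  qed
  also have "\<dots> = (\<Sum>i=1..n. q i) / (2 + L) - 1"
    using norm by (simp add: sum_subtractf sum_divide_distrib)
  also have "\<dots> \<le> 0" using q_sum L by (simp add: field_simps)
  finally have "(\<Sum>i=1..n. f i * ln (1 / f i)) - (1 + e) * (\<Sum>i=1..n. f i * ln (real (s i)))
      - (\<Sum>i=1..n. f i) * ln (2 + L) \<le> 0"
    by (simp add: right_diff_distrib sum_subtractf sum_distrib_left sum_distrib_right mult_ac)
  moreover have "(\<Sum>i=1..n. f i * ln (1 / f i)) = frequency_entropy n f * ln 2"
    by (simp add: frequency_entropy_def log_def sum_distrib_right)
  moreover have "(\<Sum>i=1..n. f i * ln (real (s i))) = L * ln 2"
    by (simp add: L_def log_def sum_distrib_right)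
  moreover have "ln (2 + L) = log 2 (2 + L) * ln 2" by (simp add: log_def)
  ultimately have "(frequency_entropy n f - (1 + e) * L - log 2 (2 + L)) * ln 2 \<le> 0"
    using norm by (simp add: algebra_simps)
  then have "frequency_entropy n f - (1 + e) * L - log 2 (2 + L) \<le> 0"
    by (simp add: mult_le_0_iff)
  moreover have "e * L \<le> 1" using L by (simp add: e_def field_simps)
  ultimately show "frequency_entropy n f \<le> L + 1 + log 2 (2 + L)"
    by (simp add: algebra_simps)
qed

text \<open>The mean logarithm \<open>L\<close> of an optimal permutation is at most the optimum
  plus a correction that again involves \<open>L\<close>. A crude linear bound
  \<open>L \<le> E + 2 * opt n f c\<close> removes \<open>L\<close> from inside the
  logarithms.\<close>

lemma entropy_le_opt:
  assumes inst: "osa_instance n f c" and norm: "(\<Sum>i=1..n. f i) = 1" and C: "0 \<le> C" and D: "0 \<le> D"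
    and dev: "\<And>j. 1 \<le> j \<Longrightarrow> log 2 (real j) \<le> c j + (C * ln (1 + log 2 (real j)) + D)"
  defines "E \<equiv> 2 * (C * ln (1 + 2 * C) + D)"
  shows "frequency_entropy n f \<le> opt n f c
    + (C * ln (1 + E + 2 * opt n f c) + log 2 (2 + E + 2 * opt n f c) + (D + 1))"
proof -
  have pos: "\<And>i. i \<in> {1..n} \<Longrightarrow> 0 < f i" using inst by (auto simp: osa_instance_def)
  obtain s where s: "s permutes {1..n}" "opt n f c = assignment_cost n f c s"
    by (rule opt_attained)
  have s_ge: "1 \<le> s i" if "i \<in> {1..n}" for i
    using permutes_in_image[OF s(1), of i] that by simp
  have s_log: "0 \<le> log 2 (real (s i))" if "i \<in> {1..n}" for i
    using s_ge[OF that] by simp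
  define L where "L = (\<Sum>i=1..n. f i * log 2 (real (s i)))"
  note L = entropy_le_mean_log[OF inst norm s(1), folded L_def]
  have E: "0 \<le> E" unfolding E_def using C D by simp
  have "L \<le> (\<Sum>i=1..n. f i * (c (s i) + (C * ln (1 + log 2 (real (s i))) + D)))"
    unfolding L_def using pos s_ge by (intro sum_mono mult_left_mono dev) (auto simp: less_imp_le)
  also have "\<dots> = opt n f c + (\<Sum>i=1..n. f i * (C * ln (1 + log 2 (real (s i))) + D))"
    unfolding s(2) assignment_cost_def sum.distrib[symmetric] distrib_left[symmetric] ..
  \<comment> \<open>Here the tangent point is the mean \<open>L\<close> itself, so the linear term
    cancels.\<close>
  also have "\<dots> \<le> opt n f c + (C * (ln (1 + L) + ((\<Sum>i=1..n. f i * log 2 (real (s i))) - L) / (1 + L)) + D)"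
    using pos s_log norm C L(1) by (intro add_left_mono weighted_log_cost_le) (auto simp: less_imp_le)
  finally have L_opt: "L \<le> opt n f c + (C * ln (1 + L) + D)" by (simp add: L_def)
  \<comment> \<open>At the point \<open>2 * C\<close> the tangent has slope
    \<open>C / (1 + 2 * C)\<close>, which is below \<open>1 / 2\<close>, so half of \<open>L\<close>
    can be absorbed on the left; this explains \<open>E\<close>.\<close>
  have "C * ln (1 + L) \<le> C * (ln (1 + 2 * C) + (L - 2 * C) / (1 + 2 * C))"
    using C L(1) by (intro mult_left_mono ln_one_plus_tangent) auto
  also have "\<dots> \<le> C * ln (1 + 2 * C) + L / 2"
    using C L(1) by (simp add: field_simps)
  finally have L_le: "L \<le> E + 2 * opt n f c"
    using L_opt by (simp add: E_def algebra_simps)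
  have "C * ln (1 + L) \<le> C * ln (1 + E + 2 * opt n f c)"
    using L_le L(1) C by (intro mult_left_mono ln_mono) auto
  moreover have "log 2 (2 + L) \<le> log 2 (2 + E + 2 * opt n f c)"
    using L_le L(1) by (intro log_mono) auto
  ultimately show ?thesis using L(2) L_opt by linarith
qed

section \<open>Assembly of the three claims\<close>

lemma affine_ln_in_bigo_ln:
  fixes a b C :: real
  assumes "0 < b"
  shows "(\<lambda>x. C * ln (a + b * x)) \<in> O(\<lambda>x. ln x)"
proof -
  have "(\<lambda>x. ln (a + b * x)) \<in> O(\<lambda>x. ln x)" using assms by real_asymp
  then show ?thesis by (cases "C = 0") auto
qed

theorem theorem2:
  shows
    "(\<forall>K::nat.
        competitive_ratio fcfs
          {(n, f, c). osa_instance n f c \<and> card {i \<in> {1..n}. c i < Max (c ` {1..n})} \<le> K}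
        \<le> ereal (1 + harm K))
     \<and> competitive_ratio fcfs {(n, f, c). osa_instance n f c \<and> concave_costs n c} \<le> 2
     \<and> (\<forall>c :: nat \<Rightarrow> real.
          (\<lambda>j. c j - log 2 (real j)) \<in> O(\<lambda>j. ln (ln (real j))) \<longrightarrow>
          (\<exists>g h :: real \<Rightarrow> real.
             g \<in> O(\<lambda>x. ln x) \<and> h \<in> O(\<lambda>x. ln x) \<and>
             (\<forall>n f. osa_instance n f c \<and> (\<Sum>i=1..n. f i) = 1 \<longrightarrow>
                expected_cost fcfs n f c \<le> frequency_entropy n f + g (frequency_entropy n f) \<and>
                frequency_entropy n f \<le> opt n f c + h (opt n f c))))"
proof (intro conjI allI impI)
  fix K :: nat
  show "competitive_ratio fcfs
      {(n, f, c). osa_instance n f c \<and> card {i \<in> {1..n}. c i < Max (c ` {1..n})} \<le> K}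
      \<le> ereal (1 + harm K)"
    using harm_nonneg[of K, where 'a=real]
    by (intro competitive_ratio_fcfs_le) (use expected_cost_fcfs_le_general in auto)
next
  have "competitive_ratio fcfs {(n, f, c). osa_instance n f c \<and> concave_costs n c} \<le> ereal 2"
    by (intro competitive_ratio_fcfs_le) (use expected_cost_fcfs_le_concave in auto)
  then show "competitive_ratio fcfs {(n, f, c). osa_instance n f c \<and> concave_costs n c} \<le> 2"
    by simp
next
  fix c :: "nat \<Rightarrow> real"
  assume "(\<lambda>j. c j - log 2 (real j)) \<in> O(\<lambda>j. ln (ln (real j)))"
  then obtain C D where C: "0 \<le> C" and D: "0 \<le> D"
    and dev: "\<And>j. 1 \<le> j \<Longrightarrow> \<bar>c j - log 2 (real j)\<bar> \<le> C * ln (1 + log 2 (real j)) + D"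
    using log_cost_deviation by blast
  define E where "E = 2 * (C * ln (1 + 2 * C) + D)"
  \<comment> \<open>Both error functions are fixed before \<open>n\<close> and \<open>f\<close>:
    they are built from \<open>C\<close>, \<open>D\<close> and \<open>E\<close>, which come from
    \<open>c\<close> alone.\<close>
  define g where "g x = C * ln (1 + x) + D" for x
  define h where "h x = C * ln (1 + E + 2 * x) + log 2 (2 + E + 2 * x) + (D + 1)" for x
  have const: "(\<lambda>x::real. a) \<in> O(\<lambda>x. ln x)" for a :: real by real_asymp
  have "g \<in> O(\<lambda>x. ln x)"
    unfolding g_def using affine_ln_in_bigo_ln[of 1 C 1] const by (intro sum_in_bigo) auto
  moreover have "h \<in> O(\<lambda>x. ln x)"
    unfolding h_def log_def
    using affine_ln_in_bigo_ln[of 2 C "1 + E"] affine_ln_in_bigo_ln[of 2 "1 / ln 2" "2 + E"] const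
    by (intro sum_in_bigo) auto
  moreover have "expected_cost fcfs n f c \<le> frequency_entropy n f + g (frequency_entropy n f) \<and>
      frequency_entropy n f \<le> opt n f c + h (opt n f c)"
    if "osa_instance n f c \<and> (\<Sum>i=1..n. f i) = 1" for n f
  proof
    have upper: "c j \<le> log 2 (real j) + (C * ln (1 + log 2 (real j)) + D)"
      and lower: "log 2 (real j) \<le> c j + (C * ln (1 + log 2 (real j)) + D)" if "1 \<le> j" for j
      using dev[OF that] by linarith+
    show "expected_cost fcfs n f c \<le> frequency_entropy n f + g (frequency_entropy n f)"
      unfolding g_def using that C upper by (intro expected_cost_fcfs_le_entropy) auto
    show "frequency_entropy n f \<le> opt n f c + h (opt n f c)"
      unfolding h_def E_def using that C D lower by (intro entropy_le_opt) auto
  qed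
  ultimately show "\<exists>g h :: real \<Rightarrow> real.
      g \<in> O(\<lambda>x. ln x) \<and> h \<in> O(\<lambda>x. ln x) \<and>
      (\<forall>n f. osa_instance n f c \<and> (\<Sum>i=1..n. f i) = 1 \<longrightarrow>
        expected_cost fcfs n f c \<le> frequency_entropy n f + g (frequency_entropy n f) \<and>
        frequency_entropy n f \<le> opt n f c + h (opt n f c))"
    by blast
qed

end
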